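(* Let $\beta$ and $\eta$ be non-degenerate symmetric bilinear forms in $\mathrm{Ver}_4^+$ on $m\mathbb{1}\oplus nP$ and $p\mathbb{1}\oplus qP$ respectively. Then the class (among A, B, C, D, E$(a)$, F$(a)$) of the sum $\beta+\eta$, a form on $(m+p)\mathbb{1}\oplus(n+q)P$, is determined by the classes of $\beta$ and $\eta$ as follows, for all $a,b\in\mathbb{K}$ (the remaining cases are given by commutativity of the sum). - If $\eta$ is in A: $\beta+\eta$ is in A if $\beta$ is in A, C or D; and in B if $\beta$ is in B, E$(a)$ or F$(a)$. - If $\eta$ is in B: $\beta+\eta$ is in B, whatever the class of $\beta$. - If $\eta$ is in C: $\beta+\eta$ is in C, D, E$(a)$, F$(a)$ when $\beta$ is in C, D, E$(a)$, F$(a)$ respectively. - If $\eta$ is in D: $\beta+\eta$ is in D if $\beta$ is in D; in F$(na)$ if $\beta$ is in E$(a)$; in F$(a)$ if $\beta$ is in F$(a)$. - If $\eta$ is in E$(b)$: if $\beta$ is in E$(a)$, then $\beta+\eta$ is in E$(a)$ when $a=b$ and in F$(na+qb)$ when $a\ne b$; if $\beta$ is in F$(a)$, then $\beta+\eta$ is in F$(a+qb)$. - If $\eta$ is in F$(b)$ and $\beta$ is in F$(a)$, then $\beta+\eta$ is in F$(a+b)$.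
   Context: $\mathbb{K}$ is an algebraically closed field of characteristic $2$. $\mathrm{Ver}_4^+$ is the symmetric tensor category whose objects are (finite-dimensional) modules over $A=\mathbb{K}[t]/(t^2)$, whose morphisms are linear maps commuting with $t$, with tensor product action $t.(u\otimes u')=(t.u)\otimes u'+u\otimes(t.u')$, unit object $\mathbb{1}=\mathbb{K}$ (with $t$ acting by $0$), and braiding $c_{U,U'}(u\otimes u')=u'\otimes u+(t.u')\otimes(t.u)$. $P$ is the two-dimensional indecomposable module, with basis $w,x$, $t.w=x$, $t.x=0$. Every object is isomorphic to $m\mathbb{1}\oplus nP$ for unique $m,n\ge0$. A bilinear form on $U$ is a morphism $\beta:U\otimes U\to\mathbb{1}$ (so $\beta(t.u,u')=\beta(u,t.u')$). It is symmetric if $\beta\circ c_{U,U}=\beta$, and non-degenerate if the induced map $U\to U^*$ is an isomorphism. Forms $\beta$ on $U$ and $\gamma$ on $U'$ are isomorphic if there is an isomorphism $\phi:U'\to U$ with $\gamma=\beta\circ(\phi\otimes\phi)$. The sum $\beta+\gamma$ is the orthogonal direct sum form on $U\oplus U'$; $k\beta$ ($k\ge0$ an integer) is the sum of $k$ copies. Named forms: $\alpha_1^m$ is the form on $m\mathbb{1}$ with identity Gram matrix; $\alpha_2^m$ ($m$ even) is the form on $m\mathbb{1}$ with Gram matrix the block-diagonal sum of $m/2$ copies of $\begin{bmatrix}0&1\\1&0\end{bmatrix}$. $\beta_P(y)$ is the form on $P$ with Gram matrix $\begin{bmatrix}y&1\\1&0\end{bmatrix}$ in the basis $w,t.w$.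 For $i\in\{0,1\}$, $\beta_{2P}(i)$ is the form on $2P$ with Gram matrix $\begin{bmatrix}i&0&0&1\\0&0&1&0\\0&1&0&0\\1&0&0&0\end{bmatrix}$ in a basis $w_1,t.w_1,w_2,t.w_2$. A form on $m\mathbb{1}\oplus nP$ is in class A if isomorphic to $\alpha_1^m+\frac n2\beta_{2P}(0)$ ($m>0$, $2\mid n$); B if isomorphic to $\alpha_1^m+n\beta_P(0)$ ($m>0$, $n>0$); C if isomorphic to $\alpha_2^m+\frac n2\beta_{2P}(0)$ ($2\mid m$, $2\mid n$); D if isomorphic to $\alpha_2^m+\beta_{2P}(1)+\frac{n-2}2\beta_{2P}(0)$ ($2\mid m$, $2\mid n$, $n\ge2$); E$(a)$ if isomorphic to $\alpha_2^m+n\beta_P(a)$ ($2\mid m$, $n>0$); F$(a)$ if isomorphic to $\alpha_2^m+(n-2)\beta_P(0)+\beta_P(1)+\beta_P(1+a)$ ($2\mid m$, $n\ge2$, $(a,n)\ne(0,2)$). Every non-degenerate symmetric bilinear form belongs to exactly one of these classes. Integers multiplying scalars (e.g. $na$) are read in $\mathbb{K}$. *)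

theory Defs
  imports
    "HOL-Computational_Algebra.Polynomial"
    "HOL-Library.Function_Algebras"
    "HOL-Library.Product_Plus"
    "Jordan_Normal_Form.Matrix"
begin

section \<open>The category \<open>Ver\<^sub>4\<^sup>+\<close>\<close>

text \<open>
  A module over \<open>K[t]/(t\<^sup>2)\<close> is a subspace \<open>vcar\<close> of an ambient \<open>K\<close>-vector space with
  scaling \<open>vscale\<close>, together with the operator \<open>vact\<close> by which \<open>t\<close> acts.
  Values of \<open>vact\<close> outside \<open>vcar\<close> are irrelevant.
\<close>

record ('k, 'v) vobj =
  vscale :: "'k \<Rightarrow> 'v \<Rightarrow> 'v"
  vcar :: "'v set"
  vact :: "'v \<Rightarrow> 'v"

definition klinear :: "('k, 'v::ab_group_add) vobj \<Rightarrow> ('k, 'w::ab_group_add) vobj \<Rightarrow> ('v \<Rightarrow> 'w) \<Rightarrow> bool" where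
  "klinear U V f \<longleftrightarrow>
     f ` vcar U \<subseteq> vcar V \<and>
     (\<forall>u\<in>vcar U. \<forall>u'\<in>vcar U. f (u + u') = f u + f u') \<and>
     (\<forall>c. \<forall>u\<in>vcar U. f (vscale U c u) = vscale V c (f u))"

definition ver4_obj :: "('k::field, 'v::ab_group_add) vobj \<Rightarrow> bool" where
  "ver4_obj U \<longleftrightarrow>
     vector_space (vscale U) \<and>
     module.subspace (vscale U) (vcar U) \<and>
     (\<exists>B. finite B \<and> module.span (vscale U) B = vcar U) \<and>
     klinear U U (vact U) \<and>
     (\<forall>u\<in>vcar U. vact U (vact U u) = 0)"

definition ver4_hom :: "('k, 'v::ab_group_add) vobj \<Rightarrow> ('k, 'w::ab_group_add) vobj \<Rightarrow> ('v \<Rightarrow> 'w) \<Rightarrow> bool" where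
  "ver4_hom U V f \<longleftrightarrow> klinear U V f \<and> (\<forall>u\<in>vcar U. f (vact U u) = vact V (f u))"

definition ver4_iso :: "('k, 'v::ab_group_add) vobj \<Rightarrow> ('k, 'w::ab_group_add) vobj \<Rightarrow> ('v \<Rightarrow> 'w) \<Rightarrow> bool" where
  "ver4_iso U V f \<longleftrightarrow> ver4_hom U V f \<and> bij_betw f (vcar U) (vcar V)"

definition obj_isomorphic :: "('k, 'v::ab_group_add) vobj \<Rightarrow> ('k, 'w::ab_group_add) vobj \<Rightarrow> bool" where
  "obj_isomorphic U V \<longleftrightarrow> (\<exists>f. ver4_iso U V f)"

definition obj_unit :: "('k::field, 'k) vobj" where
  "obj_unit = \<lparr>vscale = (*), vcar = UNIV, vact = (\<lambda>_. 0)\<rparr>"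

text \<open>The pair \<open>(a, b)\<close> stands for \<open>a w + b x\<close>, where \<open>t w = x\<close> and \<open>t x = 0\<close>.\<close>

definition obj_P :: "('k::field, 'k \<times> 'k) vobj" where
  "obj_P = \<lparr>vscale = (\<lambda>c (a, b). (c * a, c * b)), vcar = UNIV, vact = (\<lambda>(a, b). (0, a))\<rparr>"

definition obj_sum :: "('k, 'u) vobj \<Rightarrow> ('k, 'v) vobj \<Rightarrow> ('k, 'u \<times> 'v) vobj" where
  "obj_sum U V =
     \<lparr>vscale = (\<lambda>c (u, v). (vscale U c u, vscale V c v)),
      vcar = vcar U \<times> vcar V,
      vact = (\<lambda>(u, v). (vact U u, vact V v))\<rparr>"

text \<open>The direct sum of \<open>k\<close> copies consists of the sequences supported on \<open>{..<k}\<close>.\<close>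

definition obj_copies :: "nat \<Rightarrow> ('k, 'v::zero) vobj \<Rightarrow> ('k, nat \<Rightarrow> 'v) vobj" where
  "obj_copies k U =
     \<lparr>vscale = (\<lambda>c f i. vscale U c (f i)),
      vcar = {f. (\<forall>i<k. f i \<in> vcar U) \<and> (\<forall>i\<ge>k. f i = 0)},
      vact = (\<lambda>f i. vact U (f i))\<rparr>"

definition obj_mn :: "nat \<Rightarrow> nat \<Rightarrow> ('k::field, (nat \<Rightarrow> 'k) \<times> (nat \<Rightarrow> 'k \<times> 'k)) vobj" where
  "obj_mn m n = obj_sum (obj_copies m obj_unit) (obj_copies n obj_P)"

text \<open>
  The dual \<open>U\<^sup>*\<close>; functionals on \<open>vcar U\<close> are extended by \<open>0\<close>. The element \<open>t\<close> is primitive,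
  so its antipode is \<open>- t\<close> (which equals \<open>t\<close> in characteristic \<open>2\<close>).
\<close>

definition obj_dual :: "('k::field, 'v::ab_group_add) vobj \<Rightarrow> ('k, 'v \<Rightarrow> 'k) vobj" where
  "obj_dual U =
     \<lparr>vscale = (\<lambda>c f v. c * f v),
      vcar = {f. klinear U obj_unit f \<and> (\<forall>v. v \<notin> vcar U \<longrightarrow> f v = 0)},
      vact = (\<lambda>f v. if v \<in> vcar U then - f (vact U v) else 0)\<rparr>"


section \<open>Bilinear forms\<close>

record ('k, 'v) vform =
  fobj :: "('k, 'v) vobj"
  fval :: "'v \<Rightarrow> 'v \<Rightarrow> 'k"

text \<open>
  A linear map \<open>U \<otimes> U \<rightarrow> K\<close> is represented by the corresponding bilinear map. The last clause
  says that it commutes with \<open>t\<close>, which acts on \<open>u \<otimes> u'\<close> as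
  \<open>t u \<otimes> u' + u \<otimes> t u'\<close> and on the unit object by \<open>0\<close>.
\<close>

definition bilinear_form :: "('k::field, 'v::ab_group_add) vform \<Rightarrow> bool" where
  "bilinear_form \<beta> \<longleftrightarrow> (let U = fobj \<beta>; b = fval \<beta>; t = vact U in
     ver4_obj U \<and>
     (\<forall>u\<in>vcar U. klinear U obj_unit (\<lambda>u'. b u u')) \<and>
     (\<forall>u'\<in>vcar U. klinear U obj_unit (\<lambda>u. b u u')) \<and>
     (\<forall>u\<in>vcar U. \<forall>u'\<in>vcar U. b (t u) u' + b u (t u') = 0))"

text \<open>Invariance under the braiding \<open>u \<otimes> u' \<mapsto> u' \<otimes> u + t u' \<otimes> t u\<close>.\<close>

definition symmetric_form :: "('k::field, 'v::ab_group_add) vform \<Rightarrow> bool" where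
  "symmetric_form \<beta> \<longleftrightarrow> (let U = fobj \<beta>; b = fval \<beta>; t = vact U in
     \<forall>u\<in>vcar U. \<forall>u'\<in>vcar U. b u' u + b (t u') (t u) = b u u')"

definition nondegenerate_form :: "('k::field, 'v::ab_group_add) vform \<Rightarrow> bool" where
  "nondegenerate_form \<beta> \<longleftrightarrow> (let U = fobj \<beta> in
     ver4_iso U (obj_dual U) (\<lambda>u u'. if u' \<in> vcar U then fval \<beta> u u' else 0))"

definition nondeg_sym_form :: "('k::field, 'v::ab_group_add) vform \<Rightarrow> bool" where
  "nondeg_sym_form \<beta> \<longleftrightarrow> bilinear_form \<beta> \<and> symmetric_form \<beta> \<and> nondegenerate_form \<beta>"

definition form_isomorphic :: "('k, 'v::ab_group_add) vform \<Rightarrow> ('k, 'w::ab_group_add) vform \<Rightarrow> bool" where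
  "form_isomorphic \<beta> \<gamma> \<longleftrightarrow>
     (\<exists>\<phi>. ver4_iso (fobj \<gamma>) (fobj \<beta>) \<phi> \<and>
          (\<forall>u\<in>vcar (fobj \<gamma>). \<forall>u'\<in>vcar (fobj \<gamma>). fval \<gamma> u u' = fval \<beta> (\<phi> u) (\<phi> u')))"

definition form_sum :: "('k::field, 'u) vform \<Rightarrow> ('k, 'v) vform \<Rightarrow> ('k, 'u \<times> 'v) vform" (infixl "\<boxplus>" 65) where
  "\<beta> \<boxplus> \<gamma> =
     \<lparr>fobj = obj_sum (fobj \<beta>) (fobj \<gamma>),
      fval = (\<lambda>(u, v) (u', v'). fval \<beta> u u' + fval \<gamma> v v')\<rparr>"

definition form_copies :: "nat \<Rightarrow> ('k::field, 'v::zero) vform \<Rightarrow> ('k, nat \<Rightarrow> 'v) vform" where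
  "form_copies k \<beta> =
     \<lparr>fobj = obj_copies k (fobj \<beta>),
      fval = (\<lambda>f g. \<Sum>i<k. fval \<beta> (f i) (g i))\<rparr>"


section \<open>The named forms and the classes\<close>

definition gram :: "'k::field mat \<Rightarrow> 'k vec \<Rightarrow> 'k vec \<Rightarrow> 'k" where
  "gram G u v = scalar_prod u (mult_mat_vec G v)"

definition form_alpha1 :: "nat \<Rightarrow> ('k::field, nat \<Rightarrow> 'k) vform" where
  "form_alpha1 m =
     \<lparr>fobj = obj_copies m obj_unit,
      fval = (\<lambda>f g. gram (1\<^sub>m m) (vec m f) (vec m g))\<rparr>"

text \<open>Only meaningful for even \<open>m\<close>.\<close>

definition form_alpha2 :: "nat \<Rightarrow> ('k::field, nat \<Rightarrow> 'k) vform" where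
  "form_alpha2 m =
     \<lparr>fobj = obj_copies m obj_unit,
      fval = (\<lambda>f g. gram
        (diag_block_mat (replicate (m div 2) (mat_of_rows_list 2 [[0, 1], [1, 0]])))
        (vec m f) (vec m g))\<rparr>"

definition form_P :: "'k::field \<Rightarrow> ('k, 'k \<times> 'k) vform" where
  "form_P y =
     \<lparr>fobj = obj_P,
      fval = (\<lambda>(a, b) (a', b'). gram
        (mat_of_rows_list 2
          [[y, 1],
           [1, 0]])
        (vec_of_list [a, b]) (vec_of_list [a', b']))\<rparr>"

definition form_2P :: "'k::field \<Rightarrow> ('k, ('k \<times> 'k) \<times> ('k \<times> 'k)) vform" where
  "form_2P y =
     \<lparr>fobj = obj_sum obj_P obj_P,
      fval = (\<lambda>((a, b), (c, d)) ((a', b'), (c', d')). gram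
        (mat_of_rows_list 4
          [[y, 0, 0, 1],
           [0, 0, 1, 0],
           [0, 1, 0, 0],
           [1, 0, 0, 0]])
        (vec_of_list [a, b, c, d]) (vec_of_list [a', b', c', d']))\<rparr>"

datatype 'k form_class = ClassA | ClassB | ClassC | ClassD | ClassE 'k | ClassF 'k

text \<open>\<open>in_class X m n \<beta>\<close>: the form \<open>\<beta>\<close>, on an object isomorphic to \<open>m\<one> \<oplus> nP\<close>, is in class \<open>X\<close>.\<close>

fun in_class :: "'k::field form_class \<Rightarrow> nat \<Rightarrow> nat \<Rightarrow> ('k, 'v::ab_group_add) vform \<Rightarrow> bool" where
  "in_class ClassA m n \<beta> \<longleftrightarrow> m > 0 \<and> even n \<and>
     form_isomorphic \<beta> (form_alpha1 m \<boxplus> form_copies (n div 2) (form_2P 0))"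
| "in_class ClassB m n \<beta> \<longleftrightarrow> m > 0 \<and> n > 0 \<and>
     form_isomorphic \<beta> (form_alpha1 m \<boxplus> form_copies n (form_P 0))"
| "in_class ClassC m n \<beta> \<longleftrightarrow> even m \<and> even n \<and>
     form_isomorphic \<beta> (form_alpha2 m \<boxplus> form_copies (n div 2) (form_2P 0))"
| "in_class ClassD m n \<beta> \<longleftrightarrow> even m \<and> even n \<and> n \<ge> 2 \<and>
     form_isomorphic \<beta> (form_alpha2 m \<boxplus> form_2P 1 \<boxplus> form_copies ((n - 2) div 2) (form_2P 0))"
| "in_class (ClassE a) m n \<beta> \<longleftrightarrow> even m \<and> n > 0 \<and>
     form_isomorphic \<beta> (form_alpha2 m \<boxplus> form_copies n (form_P a))"
| "in_class (ClassF a) m n \<beta> \<longleftrightarrow> even m \<and> n \<ge> 2 \<and> (a, n) \<noteq> (0, 2) \<and>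
     form_isomorphic \<beta>
       (form_alpha2 m \<boxplus> form_copies (n - 2) (form_P 0) \<boxplus> form_P 1 \<boxplus> form_P (1 + a))"

end

(*
  A form is recorded by the multiset of its indecomposable summands, and the classes are read off
  from a normal form of such multisets modulo the isomorphism relations between small sums. These
  relations come from reading a form on nP as a symmetric bilinear form over K[t]/(t^2): there
  beta_P(y) is the rank one form <1 + t y>, and beta_2P(y) has Gram matrix [[t y, 1], [1, 0]].
  Squares in K[t]/(t^2) lie in K, so rescaling cannot change y, but in P(a) + P(b) with a \<noteq> b the
  pair (a, b) can be replaced by any pair with the same sum. Hence a sum of forms beta_P(y) whose
  parameters are not all equal is determined by their number and their sum; this gives the
  parameters in the rows E and F.
*)
theory Submission
  imports Defs
begin

section \<open>Isometries and orthogonal sums\<close>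

text \<open>The form over K[t]/(t^2) behind \<beta> is B(u, u') = \<beta>(t u, u') + t \<beta>(u,
  u'). Invariance under t makes it K[t]/(t^2)-bilinear, and it is symmetric in the ordinary sense
  because \<beta>(t u', t u) = \<beta>(t^2 u', u) = 0. The sum of the labels is a discriminant: a
  sum of forms <1 + t a_i> has determinant 1 + t (a_1 + ... + a_n), and a change of basis multiplies
  it by a square, hence by a scalar in K. The blocks \<open>BQ y\<close> have determinant 1 and
  contribute nothing. Equal labels are rigid, since p w_1 + q w_2 in P(a) + P(a) has norm (p + q)^2
  (1 + t a). This is why class E stands apart from F. A summand \<open>BQ 1\<close> breaks the
  rigidity, because next to \<open>BP x\<close> it can be traded for two blocks
  \<open>BP (1 + x)\<close>. A unit vector e destroys labels altogether: w can be moved to w + s e,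
  which shifts \<beta>(w, w) by s^2, and every scalar is a square. No invariants are computed: each
  entry of the table comes from isometries to the normal form, together with a check of the
  numerical side conditions.\<close>

notation form_isomorphic (infix "\<simeq>" 50)

text \<open>With the inverse supplied explicitly, an isomorphism in coordinates reduces to
  polynomial identities. As in the definition, \<open>\<phi>\<close> runs from the right-hand form
  to the left-hand one.\<close>

lemma form_isomorphicI:
  fixes \<beta> :: "('k, 'v::ab_group_add) vform" and \<gamma> :: "('k, 'w::ab_group_add) vform"
  assumes "\<And>u. u \<in> vcar (fobj \<gamma>) \<Longrightarrow> \<phi> u \<in> vcar (fobj \<beta>)"
    and "\<And>v. v \<in> vcar (fobj \<beta>) \<Longrightarrow> \<psi> v \<in> vcar (fobj \<gamma>)"
    and "\<And>u. u \<in> vcar (fobj \<gamma>) \<Longrightarrow> \<psi> (\<phi> u) = u"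
    and "\<And>v. v \<in> vcar (fobj \<beta>) \<Longrightarrow> \<phi> (\<psi> v) = v"
    and "\<And>u u'. u \<in> vcar (fobj \<gamma>) \<Longrightarrow> u' \<in> vcar (fobj \<gamma>) \<Longrightarrow> \<phi> (u + u') = \<phi> u + \<phi> u'"
    and "\<And>c u. u \<in> vcar (fobj \<gamma>) \<Longrightarrow> \<phi> (vscale (fobj \<gamma>) c u) = vscale (fobj \<beta>) c (\<phi> u)"
    and "\<And>u. u \<in> vcar (fobj \<gamma>) \<Longrightarrow> \<phi> (vact (fobj \<gamma>) u) = vact (fobj \<beta>) (\<phi> u)"
    and "\<And>u u'. u \<in> vcar (fobj \<gamma>) \<Longrightarrow> u' \<in> vcar (fobj \<gamma>) \<Longrightarrow>
           fval \<gamma> u u' = fval \<beta> (\<phi> u) (\<phi> u')"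
  shows "\<beta> \<simeq> \<gamma>"
proof -
  have "bij_betw \<phi> (vcar (fobj \<gamma>)) (vcar (fobj \<beta>))"
    by (rule bij_betw_byWitness[where f' = \<psi>]) (auto simp: assms)
  then show ?thesis
    unfolding form_isomorphic_def ver4_iso_def ver4_hom_def klinear_def
    by (intro exI[of _ \<phi>]) (auto simp: assms(1,5-8))
qed

definition isometry :: "('k, 'v::ab_group_add) vform \<Rightarrow> ('k, 'w::ab_group_add) vform \<Rightarrow> ('w \<Rightarrow> 'v) \<Rightarrow> bool" where
  "isometry \<beta> \<gamma> \<phi> \<longleftrightarrow> ver4_iso (fobj \<gamma>) (fobj \<beta>) \<phi> \<and>
     (\<forall>u\<in>vcar (fobj \<gamma>). \<forall>u'\<in>vcar (fobj \<gamma>). fval \<gamma> u u' = fval \<beta> (\<phi> u) (\<phi> u'))"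

lemma form_isomorphic_iff: "\<beta> \<simeq> \<gamma> \<longleftrightarrow> (\<exists>\<phi>. isometry \<beta> \<gamma> \<phi>)"
  by (simp add: form_isomorphic_def isometry_def)

lemma isometryD:
  assumes "isometry \<beta> \<gamma> \<phi>"
  shows "bij_betw \<phi> (vcar (fobj \<gamma>)) (vcar (fobj \<beta>))"
    and "\<And>u. u \<in> vcar (fobj \<gamma>) \<Longrightarrow> \<phi> u \<in> vcar (fobj \<beta>)"
    and "\<And>u u'. u \<in> vcar (fobj \<gamma>) \<Longrightarrow> u' \<in> vcar (fobj \<gamma>) \<Longrightarrow> \<phi> (u + u') = \<phi> u + \<phi> u'"
    and "\<And>c u. u \<in> vcar (fobj \<gamma>) \<Longrightarrow> \<phi> (vscale (fobj \<gamma>) c u) = vscale (fobj \<beta>) c (\<phi> u)"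
    and "\<And>u. u \<in> vcar (fobj \<gamma>) \<Longrightarrow> \<phi> (vact (fobj \<gamma>) u) = vact (fobj \<beta>) (\<phi> u)"
    and "\<And>u u'. u \<in> vcar (fobj \<gamma>) \<Longrightarrow> u' \<in> vcar (fobj \<gamma>) \<Longrightarrow>
           fval \<gamma> u u' = fval \<beta> (\<phi> u) (\<phi> u')"
  using assms by (auto simp: isometry_def ver4_iso_def ver4_hom_def klinear_def)

lemma form_isomorphic_refl: "\<beta> \<simeq> \<beta>"
  by (rule form_isomorphicI[where \<phi> = id and \<psi> = id]) auto

lemma form_isomorphic_trans [trans]:
  assumes "\<beta> \<simeq> \<gamma>" "\<gamma> \<simeq> \<delta>"
  shows "\<beta> \<simeq> \<delta>"
proof -
  obtain \<phi> where "isometry \<beta> \<gamma> \<phi>"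
    using assms(1) form_isomorphic_iff by blast
  note \<phi> = isometryD[OF this]
  obtain \<psi> where "isometry \<gamma> \<delta> \<psi>"
    using assms(2) form_isomorphic_iff by blast
  note \<psi> = isometryD[OF this]
  show ?thesis
    unfolding form_isomorphic_def ver4_iso_def ver4_hom_def klinear_def
    by (rule exI[of _ "\<phi> \<circ> \<psi>"]) (auto simp: \<phi> \<psi> intro: bij_betw_trans[OF \<psi>(1) \<phi>(1)])
qed

text \<open>The part of \<open>ver4_obj\<close> that makes the inverse of an isometry linear again.
  Carriers are subsets of a type, so \<open>\<simeq>\<close> can be reversed only when the carrier
  on its right is known to be closed.\<close>

definition closed_obj :: "('k, 'v::ab_group_add) vobj \<Rightarrow> bool" where
  "closed_obj U \<longleftrightarrow>
     (\<forall>u\<in>vcar U. \<forall>u'\<in>vcar U. u + u' \<in> vcar U) \<and>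
     (\<forall>c. \<forall>u\<in>vcar U. vscale U c u \<in> vcar U) \<and>
     (\<forall>u\<in>vcar U. vact U u \<in> vcar U)"

lemma form_isomorphic_sym:
  assumes "\<beta> \<simeq> \<gamma>" and closed: "closed_obj (fobj \<gamma>)"
  shows "\<gamma> \<simeq> \<beta>"
proof -
  obtain \<phi> where "isometry \<beta> \<gamma> \<phi>"
    using assms(1) form_isomorphic_iff by blast
  note \<phi> = isometryD[OF this]
  define \<psi> where "\<psi> = inv_into (vcar (fobj \<gamma>)) \<phi>"
  have \<psi>_in: "\<psi> v \<in> vcar (fobj \<gamma>)" if "v \<in> vcar (fobj \<beta>)" for v
    using that \<phi>(1) unfolding \<psi>_def by (metis bij_betw_def inv_into_into)
  have \<phi>\<psi>: "\<phi> (\<psi> v) = v" if "v \<in> vcar (fobj \<beta>)" for v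
    using that \<phi>(1) unfolding \<psi>_def by (metis bij_betw_inv_into_right)
  have \<psi>\<phi>: "\<psi> (\<phi> u) = u" if "u \<in> vcar (fobj \<gamma>)" for u
    using that \<phi>(1) unfolding \<psi>_def by (metis bij_betw_inv_into_left)
  have \<psi>_eqI: "\<psi> v = u" if "u \<in> vcar (fobj \<gamma>)" "\<phi> u = v" for u v
    using that \<psi>\<phi> by blast
  show ?thesis
  proof (rule form_isomorphicI[where \<phi> = \<psi> and \<psi> = \<phi>])
    fix v v' assume v: "v \<in> vcar (fobj \<beta>)" "v' \<in> vcar (fobj \<beta>)"
    show "\<psi> (v + v') = \<psi> v + \<psi> v'"
      by (rule \<psi>_eqI) (use v closed in \<open>auto simp: \<phi> \<psi>_in \<phi>\<psi> closed_obj_def\<close>)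
    show "fval \<beta> v v' = fval \<gamma> (\<psi> v) (\<psi> v')"
      using v by (simp add: \<phi> \<psi>_in \<phi>\<psi>)
  next
    fix c v assume v: "v \<in> vcar (fobj \<beta>)"
    show "\<psi> (vscale (fobj \<beta>) c v) = vscale (fobj \<gamma>) c (\<psi> v)"
      by (rule \<psi>_eqI) (use v closed in \<open>auto simp: \<phi> \<psi>_in \<phi>\<psi> closed_obj_def\<close>)
    show "\<psi> (vact (fobj \<beta>) v) = vact (fobj \<gamma>) (\<psi> v)"
      by (rule \<psi>_eqI) (use v closed in \<open>auto simp: \<phi> \<psi>_in \<phi>\<psi> closed_obj_def\<close>)
  qed (auto simp: \<phi> \<psi>_in \<phi>\<psi> \<psi>\<phi>)
qed

section \<open>Orthogonal sums up to isometry\<close>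

lemma form_sum_sel [simp]:
  "vcar (fobj (\<beta> \<boxplus> \<gamma>)) = vcar (fobj \<beta>) \<times> vcar (fobj \<gamma>)"
  "vscale (fobj (\<beta> \<boxplus> \<gamma>)) c (u, v) = (vscale (fobj \<beta>) c u, vscale (fobj \<gamma>) c v)"
  "vact (fobj (\<beta> \<boxplus> \<gamma>)) (u, v) = (vact (fobj \<beta>) u, vact (fobj \<gamma>) v)"
  "fval (\<beta> \<boxplus> \<gamma>) (u, v) (u', v') = fval \<beta> u u' + fval \<gamma> v v'"
  by (simp_all add: form_sum_def obj_sum_def)

lemma form_sum_cong:
  assumes "\<beta> \<simeq> \<beta>'" "\<gamma> \<simeq> \<gamma>'"
  shows "\<beta> \<boxplus> \<gamma> \<simeq> \<beta>' \<boxplus> \<gamma>'"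
proof -
  obtain \<phi> where "isometry \<beta> \<beta>' \<phi>"
    using assms(1) form_isomorphic_iff by blast
  note \<phi> = isometryD[OF this]
  obtain \<psi> where "isometry \<gamma> \<gamma>' \<psi>"
    using assms(2) form_isomorphic_iff by blast
  note \<psi> = isometryD[OF this]
  show ?thesis
    unfolding form_isomorphic_def ver4_iso_def ver4_hom_def klinear_def
    by (rule exI[of _ "map_prod \<phi> \<psi>"]) (auto simp: \<phi> \<psi> intro: bij_betw_map_prod[OF \<phi>(1) \<psi>(1)])
qed

lemma form_sum_commute: "\<beta> \<boxplus> \<gamma> \<simeq> \<gamma> \<boxplus> \<beta>"
  by (rule form_isomorphicI[where \<phi> = prod.swap and \<psi> = prod.swap]) (auto simp: add.commute)

lemma form_sum_assoc: "\<beta> \<boxplus> \<gamma> \<boxplus> \<delta> \<simeq> \<beta> \<boxplus> (\<gamma> \<boxplus> \<delta>)"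
  by (rule form_isomorphicI[where \<phi> = "\<lambda>(u, v, w). ((u, v), w)" and \<psi> = "\<lambda>((u, v), w). (u, v, w)"])
    (auto simp: add.assoc)

text \<open>Given its own witness, since reversing \<open>form_sum_assoc\<close> by
  \<open>form_isomorphic_sym\<close> would call for closed carriers.\<close>

lemma form_sum_assoc': "\<beta> \<boxplus> (\<gamma> \<boxplus> \<delta>) \<simeq> \<beta> \<boxplus> \<gamma> \<boxplus> \<delta>"
  by (rule form_isomorphicI[where \<phi> = "\<lambda>((u, v), w). (u, v, w)" and \<psi> = "\<lambda>(u, v, w). ((u, v), w)"])
    (auto simp: add.assoc)

lemma closed_obj_sum:
  "closed_obj (fobj \<beta>) \<Longrightarrow> closed_obj (fobj \<gamma>) \<Longrightarrow> closed_obj (fobj (\<beta> \<boxplus> \<gamma>))"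
  by (auto simp: closed_obj_def)

text \<open>
  The blocks stand for \<open>\<alpha>\<^sub>1\<^sup>1\<close>, \<open>\<alpha>\<^sub>2\<^sup>2\<close>, \<open>\<beta>\<^sub>P(y)\<close> and \<open>\<beta>\<^sub>2\<^sub>P(y)\<close>.
\<close>

datatype 'k blk = BU | BH | BP 'k | BQ 'k

text \<open>
  All blocks live in \<open>2P\<close>: the unit objects sit in the kernel of \<open>t\<close>, so that scaling and the
  action of \<open>t\<close> do not depend on the block.
\<close>

fun blk_car :: "'k::field blk \<Rightarrow> (('k \<times> 'k) \<times> ('k \<times> 'k)) set" where
  "blk_car BU = {u. fst (fst u) = 0 \<and> snd u = 0}"
| "blk_car BH = {u. fst (fst u) = 0 \<and> fst (snd u) = 0}"
| "blk_car (BP y) = {u. snd u = 0}"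
| "blk_car (BQ y) = UNIV"

fun blk_val :: "'k::field blk \<Rightarrow> ('k \<times> 'k) \<times> ('k \<times> 'k) \<Rightarrow> ('k \<times> 'k) \<times> ('k \<times> 'k) \<Rightarrow> 'k" where
  "blk_val BU ((a, b), (c, d)) ((a', b'), (c', d')) = b * b'"
| "blk_val BH ((a, b), (c, d)) ((a', b'), (c', d')) = b * d' + d * b'"
| "blk_val (BP y) ((a, b), (c, d)) ((a', b'), (c', d')) = y * a * a' + a * b' + b * a'"
| "blk_val (BQ y) ((a, b), (c, d)) ((a', b'), (c', d')) = y * a * a' + a * d' + b * c' + c * b' + d * a'"

definition scale4 :: "'k::field \<Rightarrow> ('k \<times> 'k) \<times> ('k \<times> 'k) \<Rightarrow> ('k \<times> 'k) \<times> ('k \<times> 'k)" where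
  "scale4 s = (\<lambda>((a, b), (c, d)). ((s * a, s * b), (s * c, s * d)))"

definition act4 :: "('k::field \<times> 'k) \<times> ('k \<times> 'k) \<Rightarrow> ('k \<times> 'k) \<times> ('k \<times> 'k)" where
  "act4 = (\<lambda>((a, b), (c, d)). ((0, a), (0, c)))"

definition blk_form :: "'k::field blk \<Rightarrow> ('k, ('k \<times> 'k) \<times> ('k \<times> 'k)) vform" where
  "blk_form b = \<lparr>fobj = \<lparr>vscale = scale4, vcar = blk_car b, vact = act4\<rparr>, fval = blk_val b\<rparr>"

text \<open>Iterating \<open>\<boxplus>\<close> would give a type that grows with the number of
  summands. The common ambient space of the blocks makes the sum of a mixed list a form of one fixed
  type, so that induction over lists is possible.\<close>

definition blks_form :: "'k::field blk list \<Rightarrow> ('k, nat \<Rightarrow> ('k \<times> 'k) \<times> ('k \<times> 'k)) vform" where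
  "blks_form L =
     \<lparr>fobj =
        \<lparr>vscale = (\<lambda>s f i. scale4 s (f i)),
         vcar = {f. (\<forall>i<length L. f i \<in> blk_car (L ! i)) \<and> (\<forall>i\<ge>length L. f i = 0)},
         vact = (\<lambda>f i. act4 (f i))\<rparr>,
      fval = (\<lambda>f g. \<Sum>i<length L. blk_val (L ! i) (f i) (g i))\<rparr>"

lemma scale4_0 [simp]: "scale4 s 0 = 0" and act4_0 [simp]: "act4 0 = 0"
  by (simp_all add: scale4_def act4_def zero_prod_def)

lemma blk_car_closed:
  "u \<in> blk_car b \<Longrightarrow> v \<in> blk_car b \<Longrightarrow> u + v \<in> blk_car b"
  "u \<in> blk_car b \<Longrightarrow> scale4 s u \<in> blk_car b"
  "u \<in> blk_car b \<Longrightarrow> act4 u \<in> blk_car b"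
  by (cases b; auto simp: scale4_def act4_def zero_prod_def split: prod.splits)+

lemma closed_blk_form: "closed_obj (fobj (blk_form b))"
  by (simp add: closed_obj_def blk_form_def blk_car_closed)

lemma closed_blks_form: "closed_obj (fobj (blks_form L))"
  by (auto simp: closed_obj_def blks_form_def blk_car_closed)

lemma all_less_Suc_shift: "(\<forall>i<Suc k. P i) \<longleftrightarrow> P 0 \<and> (\<forall>i<k. P (Suc i))"
  by (auto simp: less_Suc_eq_0_disj)

lemma all_ge_Suc_shift: "(\<forall>i\<ge>Suc k. P i) \<longleftrightarrow> (\<forall>i\<ge>k. P (Suc i))"
  by (metis Suc_le_D Suc_le_mono)

lemma blks_form_Cons: "blks_form (b # L) \<simeq> blk_form b \<boxplus> blks_form L"
proof (rule form_isomorphicI[where \<phi> = "\<lambda>(u, f). case_nat u f" and \<psi> = "\<lambda>f. (f 0, \<lambda>i. f (Suc i))"])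
qed (auto simp: blks_form_def blk_form_def all_less_Suc_shift all_ge_Suc_shift fun_eq_iff sum.lessThan_Suc_shift
    simp del: sum.lessThan_Suc split: nat.splits)

lemma form_copies_Suc: "form_copies (Suc k) \<beta> \<simeq> \<beta> \<boxplus> form_copies k \<beta>"
proof (rule form_isomorphicI[where \<phi> = "\<lambda>(u, f). case_nat u f" and \<psi> = "\<lambda>f. (f 0, \<lambda>i. f (Suc i))"])
qed (auto simp: form_copies_def obj_copies_def all_less_Suc_shift all_ge_Suc_shift fun_eq_iff sum.lessThan_Suc_shift
    simp del: sum.lessThan_Suc split: nat.splits)

lemma blks_form_append: "blks_form (L @ M) \<simeq> blks_form L \<boxplus> blks_form M"
proof (induction L)
  case Nil
  show ?case
    by (rule form_isomorphicI[where \<phi> = snd and \<psi> = "\<lambda>v. (0, v)"])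
      (auto simp: blks_form_def fun_eq_iff)
next
  case (Cons b L)
  have "blks_form (b # (L @ M)) \<simeq> blk_form b \<boxplus> blks_form (L @ M)"
    by (rule blks_form_Cons)
  also have "\<dots> \<simeq> blk_form b \<boxplus> (blks_form L \<boxplus> blks_form M)"
    by (intro form_sum_cong form_isomorphic_refl Cons.IH)
  also have "\<dots> \<simeq> blk_form b \<boxplus> blks_form L \<boxplus> blks_form M"
    by (rule form_sum_assoc')
  also have "\<dots> \<simeq> blks_form (b # L) \<boxplus> blks_form M"
    by (intro form_sum_cong form_isomorphic_refl form_isomorphic_sym[OF blks_form_Cons]
        closed_obj_sum closed_blk_form closed_blks_form)
  finally show ?case by simp
qed

lemma blks_form_append_sym: "blks_form L \<boxplus> blks_form M \<simeq> blks_form (L @ M)"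
  by (intro form_isomorphic_sym[OF blks_form_append] closed_obj_sum closed_blks_form)

lemma blks_form_perm:
  assumes "mset L = mset M"
  shows "blks_form L \<simeq> blks_form M"
  using assms
proof (induction L arbitrary: M)
  case Nil
  then show ?case by (simp add: form_isomorphic_refl)
next
  case (Cons b L)
  then have "b \<in> set M"
    by (metis list.set_intros(1) set_mset_mset)
  then obtain M1 M2 where M: "M = M1 @ b # M2"
    by (meson split_list)
  have "blks_form (b # L) \<simeq> blk_form b \<boxplus> blks_form L"
    by (rule blks_form_Cons)
  \<comment> \<open>The remaining blocks are arranged as \<open>M2 @ M1\<close>, so that a single
    exchange of two summands restores the order of \<open>M\<close>.\<close>
  also have "\<dots> \<simeq> blk_form b \<boxplus> blks_form (M2 @ M1)"
    using Cons.prems M by (intro form_sum_cong form_isomorphic_refl Cons.IH) simp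
  also have "\<dots> \<simeq> blks_form (b # M2 @ M1)"
    by (intro form_isomorphic_sym[OF blks_form_Cons] closed_obj_sum closed_blk_form closed_blks_form)
  also have "\<dots> \<simeq> blks_form (b # M2) \<boxplus> blks_form M1"
    using blks_form_append[of "b # M2" M1] by simp
  also have "\<dots> \<simeq> blks_form M1 \<boxplus> blks_form (b # M2)"
    by (rule form_sum_commute)
  also have "\<dots> \<simeq> blks_form M"
    unfolding M by (rule blks_form_append_sym)
  finally show ?case .
qed

text \<open>Lists serve only as representatives of multisets. By \<open>blks_form_perm\<close> one
  pair of lists is enough to establish the relation, while the universal quantifier lets any
  convenient pair be used afterwards; \<open>decomposes\<close> follows the same pattern.\<close>

definition blks_equiv :: "'k::field blk multiset \<Rightarrow> 'k blk multiset \<Rightarrow> bool" (infix "\<approx>" 50) where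
  "M \<approx> N \<longleftrightarrow> (\<forall>L L'. mset L = M \<longrightarrow> mset L' = N \<longrightarrow> blks_form L \<simeq> blks_form L')"

definition decomposes :: "('k::field, 'v::ab_group_add) vform \<Rightarrow> 'k blk multiset \<Rightarrow> bool" where
  "decomposes \<beta> M \<longleftrightarrow> (\<forall>L. mset L = M \<longrightarrow> \<beta> \<simeq> blks_form L)"

lemma decomposesI: "\<beta> \<simeq> blks_form L \<Longrightarrow> mset L = M \<Longrightarrow> decomposes \<beta> M"
  unfolding decomposes_def by (metis blks_form_perm form_isomorphic_trans)

lemma blks_equivI: "blks_form L \<simeq> blks_form L' \<Longrightarrow> mset L = M \<Longrightarrow> mset L' = N \<Longrightarrow> M \<approx> N"
  unfolding blks_equiv_def by (metis blks_form_perm form_isomorphic_trans)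

lemma blks_equiv_refl: "M \<approx> M"
  using blks_equiv_def blks_form_perm by metis

lemma blks_equiv_sym: "M \<approx> N \<Longrightarrow> N \<approx> M"
  unfolding blks_equiv_def using form_isomorphic_sym closed_blks_form by metis

lemma blks_equiv_trans [trans]: "M \<approx> N \<Longrightarrow> N \<approx> K \<Longrightarrow> M \<approx> K"
  unfolding blks_equiv_def by (metis ex_mset form_isomorphic_trans)

lemma decomposes_equiv: "decomposes \<beta> M \<Longrightarrow> M \<approx> N \<Longrightarrow> decomposes \<beta> N"
  unfolding blks_equiv_def decomposes_def by (metis ex_mset form_isomorphic_trans)

lemma decomposes_sum:
  assumes "decomposes \<beta> M" "decomposes \<gamma> N"
  shows "decomposes (\<beta> \<boxplus> \<gamma>) (M + N)"
proof -
  obtain L L' where L: "mset L = M" "mset L' = N"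
    by (metis ex_mset)
  have "\<beta> \<boxplus> \<gamma> \<simeq> blks_form L \<boxplus> blks_form L'"
    using assms L by (simp add: decomposes_def form_sum_cong)
  also have "\<dots> \<simeq> blks_form (L @ L')"
    by (rule blks_form_append_sym)
  finally show ?thesis
    by (rule decomposesI) (simp add: L)
qed

lemma decomposes_iso: "\<beta> \<simeq> \<gamma> \<Longrightarrow> decomposes \<gamma> M \<Longrightarrow> decomposes \<beta> M"
  unfolding decomposes_def using form_isomorphic_trans by blast

lemma iso_of_decomposes:
  assumes "decomposes \<beta> M" "decomposes \<gamma> M"
  shows "\<beta> \<simeq> \<gamma>"
  using assms unfolding decomposes_def
  by (metis ex_mset form_isomorphic_sym form_isomorphic_trans closed_blks_form)

lemma blks_equiv_add:
  assumes "M \<approx> M'" "N \<approx> N'"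
  shows "M + N \<approx> M' + N'"
proof -
  obtain L L' K K' where L: "mset L = M" "mset L' = M'" "mset K = N" "mset K' = N'"
    by (metis ex_mset)
  have "blks_form (L @ K) \<simeq> blks_form L \<boxplus> blks_form K"
    by (rule blks_form_append)
  also have "\<dots> \<simeq> blks_form L' \<boxplus> blks_form K'"
    using assms L by (simp add: blks_equiv_def form_sum_cong)
  also have "\<dots> \<simeq> blks_form (L' @ K')"
    by (rule blks_form_append_sym)
  finally show ?thesis
    by (rule blks_equivI) (simp_all add: L)
qed

lemma blks_equiv_add_left: "N \<approx> N' \<Longrightarrow> M + N \<approx> M + N'"
  and blks_equiv_add_right: "M \<approx> M' \<Longrightarrow> M + N \<approx> M' + N"
  by (simp_all add: blks_equiv_add blks_equiv_refl)

lemma decomposes_Nil: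
  assumes "vcar (fobj \<beta>) = {0}" "vact (fobj \<beta>) 0 = 0" "\<And>c. vscale (fobj \<beta>) c 0 = 0" "fval \<beta> 0 0 = 0"
  shows "decomposes \<beta> {#}"
proof (rule decomposesI)
  show "\<beta> \<simeq> blks_form []"
    by (rule form_isomorphicI[where \<phi> = "\<lambda>_. 0" and \<psi> = "\<lambda>_. 0"])
      (auto simp: assms blks_form_def fun_eq_iff)
qed simp

lemma decomposes_blk_form: "decomposes (blk_form b) {#b#}"
proof (rule decomposesI)
  show "blk_form b \<simeq> blks_form [b]"
    by (rule form_isomorphicI[where \<phi> = "\<lambda>f. f 0" and \<psi> = "\<lambda>u i. if i = 0 then u else 0"])
      (auto simp: blk_form_def blks_form_def fun_eq_iff)
qed simp

text \<open>Allows a relation between blocks to be proved on nested pairs, where isometries can be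
  written by pattern matching, instead of on sequences.\<close>

lemma blks_equiv_of_decomposes:
  assumes "decomposes \<beta> M" "decomposes \<gamma> N" "\<beta> \<simeq> \<gamma>"
  shows "M \<approx> N"
proof -
  obtain L L' where L: "mset L = M" "mset L' = N"
    by (metis ex_mset)
  have "\<beta> \<simeq> blks_form L" "\<gamma> \<simeq> blks_form L'"
    using assms L by (auto simp: decomposes_def)
  then have "blks_form L \<simeq> blks_form L'"
    using assms form_isomorphic_sym form_isomorphic_trans closed_blks_form by metis
  then show ?thesis
    using L blks_equivI by blast
qed

section \<open>Block decompositions of the named forms\<close>

lemma form_alpha1_eq: "form_alpha1 m = form_copies m \<lparr>fobj = obj_unit, fval = (*)\<rparr>"
  by (simp add: form_alpha1_def form_copies_def gram_def scalar_prod_def lessThan_atLeast0 fun_eq_iff)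

lemma decomposes_copies:
  assumes "decomposes \<beta> M" "\<And>c. vscale (fobj \<beta>) c 0 = 0" "vact (fobj \<beta>) 0 = 0"
  shows "decomposes (form_copies k \<beta>) (repeat_mset k M)"
proof (induction k)
  case 0
  show ?case
    by (simp, rule decomposes_Nil)
      (auto simp: form_copies_def obj_copies_def fun_eq_iff assms)
next
  case (Suc k)
  show ?case
    using decomposes_iso[OF form_copies_Suc decomposes_sum[OF assms(1) Suc]] by simp
qed

lemma decomposes_alpha1: "decomposes (form_alpha1 m) (replicate_mset m BU)"
proof -
  have "decomposes \<lparr>fobj = obj_unit, fval = (*)\<rparr> ({#BU#} :: 'a blk multiset)"
  proof (rule decomposes_iso[OF _ decomposes_blk_form])
    show "\<lparr>fobj = obj_unit, fval = (*)\<rparr> \<simeq> blk_form (BU :: 'a blk)"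
      by (rule form_isomorphicI[where \<phi> = "\<lambda>((_, x), _). x" and \<psi> = "\<lambda>x. ((0, x), (0, 0))"])
        (auto simp: blk_form_def obj_unit_def scale4_def act4_def zero_prod_def)
  qed
  from decomposes_copies[OF this, of m] show ?thesis
    by (simp add: form_alpha1_eq obj_unit_def repeat_mset_replicate_mset)
qed

lemma decomposes_P: "decomposes (form_P y) {#BP y#}"
proof (rule decomposes_iso[OF _ decomposes_blk_form])
  show "form_P y \<simeq> blk_form (BP y)"
    by (rule form_isomorphicI[where \<phi> = fst and \<psi> = "\<lambda>u. (u, 0)"])
      (auto simp: blk_form_def form_P_def obj_P_def scale4_def act4_def zero_prod_def gram_def
        scalar_prod_def mat_of_rows_list_def numeral_2_eq_2 algebra_simps)
qed

lemma decomposes_2P: "decomposes (form_2P y) {#BQ y#}"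
proof (rule decomposes_iso[OF _ decomposes_blk_form])
  show "form_2P y \<simeq> blk_form (BQ y)"
    by (rule form_isomorphicI[where \<phi> = id and \<psi> = id])
      (auto simp: blk_form_def form_2P_def obj_sum_def obj_P_def scale4_def act4_def gram_def
        scalar_prod_def mat_of_rows_list_def eval_nat_numeral algebra_simps)
qed

lemma decomposes_copies_P: "decomposes (form_copies k (form_P y)) (replicate_mset k (BP y))"
  using decomposes_copies[OF decomposes_P, of y k]
  by (simp add: form_P_def obj_P_def zero_prod_def repeat_mset_replicate_mset)

lemma decomposes_copies_2P: "decomposes (form_copies k (form_2P y)) (replicate_mset k (BQ y))"
  using decomposes_copies[OF decomposes_2P, of y k]
  by (simp add: form_2P_def obj_sum_def obj_P_def zero_prod_def repeat_mset_replicate_mset)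

lemma gram_four_block_diag:
  assumes "A \<in> carrier_mat a a" "B \<in> carrier_mat b b"
    and "u \<in> carrier_vec a" "u' \<in> carrier_vec a" "v \<in> carrier_vec b" "v' \<in> carrier_vec b"
  shows "gram (four_block_mat A (0\<^sub>m a b) (0\<^sub>m b a) B) (u @\<^sub>v v) (u' @\<^sub>v v') = gram A u u' + gram B v v'"
  using assms by (auto simp: gram_def mult_mat_vec_split intro: scalar_prod_append)

text \<open>Peeling the first 2 x 2 block off the Gram matrix gives the recursion that splits off
  one hyperbolic plane \<open>BH\<close>.\<close>

lemma fval_alpha2_Suc_Suc:
  assumes "even m"
  shows "fval (form_alpha2 (Suc (Suc m))) f g =
    f 0 * g 1 + f 1 * g 0 + fval (form_alpha2 m) (\<lambda>i. f (Suc (Suc i))) (\<lambda>i. g (Suc (Suc i)))"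
proof -
  let ?H = "mat_of_rows_list 2 [[0, 1], [1, 0]] :: 'a mat"
  let ?B = "diag_block_mat (replicate (m div 2) ?H)"
  have H: "?H \<in> carrier_mat 2 2"
    by (simp add: mat_of_rows_list_def numeral_2_eq_2)
  have B: "?B \<in> carrier_mat m m"
    using assms H
    by (intro carrier_matI) (auto simp only: dim_diag_block_mat map_replicate sum_list_replicate carrier_matD
        even_two_times_div_two of_nat_id mult.commute[of _ 2])
  have split: "vec (Suc (Suc m)) h = vec 2 h @\<^sub>v vec m (\<lambda>i. h (Suc (Suc i)))" for h :: "nat \<Rightarrow> 'a"
    by (rule eq_vecI) (auto intro!: arg_cong[of _ _ h])
  have "diag_block_mat (replicate (Suc (Suc m) div 2) ?H) = four_block_mat ?H (0\<^sub>m 2 m) (0\<^sub>m m 2) ?B"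
    using H B by (simp add: Let_def)
  then have "fval (form_alpha2 (Suc (Suc m))) f g =
      gram ?H (vec 2 f) (vec 2 g) + gram ?B (vec m (\<lambda>i. f (Suc (Suc i)))) (vec m (\<lambda>i. g (Suc (Suc i))))"
    using gram_four_block_diag[OF H B, of "vec 2 f" "vec 2 g"]
    by (simp add: form_alpha2_def split)
  moreover have "gram ?H (vec 2 f) (vec 2 g) = f 0 * g 1 + f 1 * g 0"
    by (simp add: gram_def scalar_prod_def mat_of_rows_list_def numeral_2_eq_2)
  ultimately show ?thesis
    by (simp add: form_alpha2_def)
qed

lemma decomposes_alpha2_double: "decomposes (form_alpha2 (2 * k)) (replicate_mset k BH)"
proof (induction k)
  case 0
  show ?case
    by (simp, rule decomposes_Nil)
      (auto simp: form_alpha2_def obj_copies_def obj_unit_def fun_eq_iff gram_def scalar_prod_def)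
next
  case (Suc k)
  have "form_alpha2 (2 * Suc k) \<simeq> blk_form (BH :: 'a blk) \<boxplus> form_alpha2 (2 * k)"
    by (rule form_isomorphicI[where
          \<phi> = "\<lambda>(((_, x), (_, y)), f). case_nat x (case_nat y f)"
          and \<psi> = "\<lambda>f. (((0, f 0), (0, f 1)), \<lambda>i. f (Suc (Suc i)))"])
      \<comment> \<open>The values are rewritten by the recursion before
        \<open>form_alpha2_def\<close> is unfolded, which would expose the block matrix.\<close>
      (auto simp: fval_alpha2_Suc_Suc, auto simp: form_alpha2_def obj_copies_def obj_unit_def
        blk_form_def scale4_def act4_def fun_eq_iff all_ge_Suc_shift split: nat.splits)
  from decomposes_iso[OF this decomposes_sum[OF decomposes_blk_form Suc]] show ?case
    by simp
qed

lemma decomposes_alpha2: "even m \<Longrightarrow> decomposes (form_alpha2 m) (replicate_mset (m div 2) BH)"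
  using decomposes_alpha2_double[of "m div 2"] by simp

text \<open>The numerical side conditions of \<open>in_class\<close>, separated from the isomorphism
  so that the table can be stated for numbers and multisets, without any form.\<close>

fun class_ok :: "'k::field form_class \<Rightarrow> nat \<Rightarrow> nat \<Rightarrow> bool" where
  "class_ok ClassA m n \<longleftrightarrow> m > 0 \<and> even n"
| "class_ok ClassB m n \<longleftrightarrow> m > 0 \<and> n > 0"
| "class_ok ClassC m n \<longleftrightarrow> even m \<and> even n"
| "class_ok ClassD m n \<longleftrightarrow> even m \<and> even n \<and> n \<ge> 2"
| "class_ok (ClassE a) m n \<longleftrightarrow> even m \<and> n > 0"
| "class_ok (ClassF a) m n \<longleftrightarrow> even m \<and> n \<ge> 2 \<and> (a, n) \<noteq> (0, 2)"

fun class_blks :: "'k::field form_class \<Rightarrow> nat \<Rightarrow> nat \<Rightarrow> 'k blk multiset" where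
  "class_blks ClassA m n = replicate_mset m BU + replicate_mset (n div 2) (BQ 0)"
| "class_blks ClassB m n = replicate_mset m BU + replicate_mset n (BP 0)"
| "class_blks ClassC m n = replicate_mset (m div 2) BH + replicate_mset (n div 2) (BQ 0)"
| "class_blks ClassD m n =
     replicate_mset (m div 2) BH + {#BQ 1#} + replicate_mset ((n - 2) div 2) (BQ 0)"
| "class_blks (ClassE a) m n = replicate_mset (m div 2) BH + replicate_mset n (BP a)"
| "class_blks (ClassF a) m n =
     replicate_mset (m div 2) BH + replicate_mset (n - 2) (BP 0) + {#BP 1#} + {#BP (1 + a)#}"

lemma isomorphic_iff_decomposes:
  assumes "decomposes \<gamma> M"
  shows "\<beta> \<simeq> \<gamma> \<longleftrightarrow> decomposes \<beta> M"
  using assms decomposes_iso iso_of_decomposes by blast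

lemma in_class_iff: "in_class X m n \<beta> \<longleftrightarrow> class_ok X m n \<and> decomposes \<beta> (class_blks X m n)"
proof (cases X)
  case ClassA
  show ?thesis
    unfolding ClassA in_class.simps class_ok.simps class_blks.simps
    using isomorphic_iff_decomposes[OF decomposes_sum[OF decomposes_alpha1 decomposes_copies_2P]] by blast
next
  case ClassB
  show ?thesis
    unfolding ClassB in_class.simps class_ok.simps class_blks.simps
    using isomorphic_iff_decomposes[OF decomposes_sum[OF decomposes_alpha1 decomposes_copies_P]] by blast
next
  case ClassC
  show ?thesis
    unfolding ClassC in_class.simps class_ok.simps class_blks.simps
    using isomorphic_iff_decomposes[OF decomposes_sum[OF decomposes_alpha2 decomposes_copies_2P]] by blast
next
  case ClassD
  show ?thesis
    unfolding ClassD in_class.simps class_ok.simps class_blks.simps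
    using isomorphic_iff_decomposes[OF decomposes_sum[OF decomposes_sum[OF decomposes_alpha2 decomposes_2P]
        decomposes_copies_2P]] by blast
next
  case (ClassE a)
  show ?thesis
    unfolding ClassE in_class.simps class_ok.simps class_blks.simps
    using isomorphic_iff_decomposes[OF decomposes_sum[OF decomposes_alpha2 decomposes_copies_P]] by blast
next
  case (ClassF a)
  show ?thesis
    unfolding ClassF in_class.simps class_ok.simps class_blks.simps
    using isomorphic_iff_decomposes[OF decomposes_sum[OF decomposes_sum[OF decomposes_sum[OF
        decomposes_alpha2 decomposes_copies_P] decomposes_P] decomposes_P]] by blast
qed

section \<open>Relations between sums of blocks\<close>

lemma decomposes_blk2: "decomposes (blk_form b \<boxplus> blk_form c) {#b, c#}"
  using decomposes_sum[OF decomposes_blk_form[of b] decomposes_blk_form[of c]] by (simp add: add_mset_commute)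

lemma decomposes_blk3: "decomposes (blk_form b \<boxplus> (blk_form c \<boxplus> blk_form d)) {#b, c, d#}"
  using decomposes_sum[OF decomposes_blk_form[of b] decomposes_blk2[of c d]] by (simp add: add_mset_commute)

text \<open>Rewriting of a submultiset. The two equations are left as goals because the common rest
  \<open>K\<close> has to be named by hand.\<close>

lemma blks_equiv_context:
  assumes "M \<approx> N" "A = M + K" "B = N + K"
  shows "A \<approx> B"
  using assms by (simp add: blks_equiv_add_right)

text \<open>Together with \<open>blk_dimP\<close>, the multiplicities of the unit object and of P in
  the object underlying a block.\<close>

fun blk_dim1 :: "'k blk \<Rightarrow> nat" where
  "blk_dim1 BU = 1" | "blk_dim1 BH = 2" | "blk_dim1 (BP y) = 0" | "blk_dim1 (BQ y) = 0"

fun blk_dimP :: "'k blk \<Rightarrow> nat" where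
  "blk_dimP BU = 0" | "blk_dimP BH = 0" | "blk_dimP (BP y) = 1" | "blk_dimP (BQ y) = 2"

lemma replicate_mset_add: "replicate_mset (j + k) x = replicate_mset j x + replicate_mset k x"
  by (induction j) simp_all

definition class_sum_ok :: "'k::field form_class \<Rightarrow> nat \<Rightarrow> nat \<Rightarrow> 'k form_class \<Rightarrow> nat \<Rightarrow> nat \<Rightarrow> 'k form_class \<Rightarrow> bool" where
  "class_sum_ok X m n Y p q Z \<longleftrightarrow> (class_ok X m n \<longrightarrow> class_ok Y p q \<longrightarrow>
     class_ok Z (m + p) (n + q) \<and> class_blks X m n + class_blks Y p q \<approx> class_blks Z (m + p) (n + q))"

definition has_BP :: "'k::field form_class \<Rightarrow> bool" where
  "has_BP X \<longleftrightarrow> X = ClassB \<or> (\<exists>a. X = ClassE a) \<or> (\<exists>a. X = ClassF a)"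

lemma class_blks_dims:
  assumes "class_ok X m n"
  shows "(\<Sum>b\<in>#class_blks X m n. blk_dim1 b) = m" "(\<Sum>b\<in>#class_blks X m n. blk_dimP b) = n"
    and "(\<exists>y. BP y \<in># class_blks X m n) \<longleftrightarrow> has_BP X"
  using assms by (cases X; auto simp: has_BP_def)+

text \<open>The labels of the \<open>BP\<close> blocks in the normal form of class F. In
  characteristic 2 they add up to \<open>a\<close>, as 1 + (1 + a) = a.\<close>

definition F_labels :: "'k::field \<Rightarrow> nat \<Rightarrow> 'k multiset" where
  "F_labels a n = replicate_mset (n - 2) 0 + {#1, 1 + a#}"

text \<open>Here, and in \<open>class_sum_DC\<close> and \<open>class_sum_EE_eq\<close>, the two
  multisets of blocks are equal, so reflexivity suffices.\<close>

lemma class_sum_CC: "class_sum_ok ClassC m n ClassC p q ClassC"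
  by (auto simp: class_sum_ok_def div_plus_div_distrib_dvd_left replicate_mset_add ac_simps blks_equiv_refl)

lemma even_ge_2E:
  assumes "even (r :: nat)" "r \<ge> 2"
  obtains k where "r = 2 * Suc k"
  by (rule that[of "r div 2 - 1"]) (use assms in auto)

lemma class_sum_DC: "class_sum_ok ClassD m n ClassC p q ClassD"
  by (auto simp: class_sum_ok_def replicate_mset_add ac_simps blks_equiv_refl
      elim!: even_ge_2E[of n] evenE[of m] evenE[of p] evenE[of q])

lemma class_sum_EE_eq: "class_sum_ok (ClassE a) m n (ClassE a) p q (ClassE a)"
  by (auto simp: class_sum_ok_def div_plus_div_distrib_dvd_left replicate_mset_add ac_simps blks_equiv_refl)

text \<open>Both orders of summation have the same multiset of blocks, which gives the commuted
  entries of the table as well.\<close>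

lemma in_class_sum:
  assumes "class_sum_ok X m n Y p q Z" "in_class X m n \<beta>" "in_class Y p q \<eta>"
  shows "in_class Z (m + p) (n + q) (\<beta> \<boxplus> \<eta>) \<and> in_class Z (m + p) (n + q) (\<eta> \<boxplus> \<beta>)"
  using assms decomposes_sum[of \<beta> "class_blks X m n" \<eta> "class_blks Y p q"]
    decomposes_sum[of \<eta> "class_blks Y p q" \<beta> "class_blks X m n"]
  by (auto simp: in_class_iff class_sum_ok_def add.commute intro: decomposes_equiv)

section \<open>Isometries between small sums in characteristic 2, and the normal forms they
  yield\<close>

context
  assumes char2: "CHAR('k::alg_closed_field) = 2"
begin

lemma char2_two: "(2 :: 'k) = 0"
  using of_nat_CHAR[where ?'a = 'k] char2 by simp

lemma char2_double: "x + x = (0 :: 'k)"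
  using mult_2[of x] char2_two by simp

lemma char2_double_left: "x + (x + y) = (y :: 'k)"
  using char2_double[of x] by (simp add: add.assoc[symmetric])

lemma char2_eq_iff: "x = y \<longleftrightarrow> x + y = (0 :: 'k)"
  using char2_double[of y] by (metis add_right_imp_eq)

lemmas char2_simps = algebra_simps char2_double char2_double_left

lemmas blk_form_simps = blk_form_def scale4_def act4_def zero_prod_def

text \<open>
  For an orthonormal basis \<open>e\<^sub>1, e\<^sub>2, e\<^sub>3\<close>, use \<open>e\<^sub>1 + e\<^sub>2 + e\<^sub>3\<close>, \<open>e\<^sub>1 + e\<^sub>2\<close>, \<open>e\<^sub>2 + e\<^sub>3\<close>.
\<close>

lemma blks_BU_BH: "{#BU, BH#} \<approx> ({#BU, BU, BU#} :: 'k blk multiset)"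
proof (rule blks_equiv_of_decomposes[OF decomposes_blk2 decomposes_blk3])
  show "blk_form BU \<boxplus> blk_form BH \<simeq> blk_form (BU :: 'k blk) \<boxplus> (blk_form BU \<boxplus> blk_form BU)"
    by (rule form_isomorphicI[where
          \<phi> = "\<lambda>(((_, x), _), ((_, y), _), ((_, z), _)).
                 (((0, x + y + z), (0, 0)), ((0, y + z), (0, x + y)))"
          and \<psi> = "\<lambda>(((_, x), _), ((_, y), (_, z))).
                 (((0, x + y), (0, 0)), ((0, x + y + z), (0, 0)), ((0, x + z), (0, 0)))"])
      (auto simp: blk_form_simps char2_simps)
qed

text \<open>
  With \<open>e\<close> the unit vector, replace \<open>w\<^sub>1\<close> by \<open>w\<^sub>1 + s e\<close> and \<open>e\<close> by \<open>e + s t w\<^sub>2\<close>.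
\<close>

lemma blks_BU_BQ: "{#BU, BQ (s\<^sup>2)#} \<approx> ({#BU, BQ 0#} :: 'k blk multiset)"
proof (rule blks_equiv_of_decomposes[OF decomposes_blk2 decomposes_blk2])
  show "blk_form BU \<boxplus> blk_form (BQ (s\<^sup>2)) \<simeq> blk_form (BU :: 'k blk) \<boxplus> blk_form (BQ 0)"
    by (rule form_isomorphicI[where
          \<phi> = "\<lambda>(((_, e), _), ((a, b), (c, d))). (((0, e + s * a), (0, 0)), ((a, b), (c, d + s * e)))"
          and \<psi> = "\<lambda>(((_, e), _), ((a, b), (c, d))).
                 (((0, e + s * a), (0, 0)), ((a, b), (c, d + s * e + s\<^sup>2 * a)))"])
      (auto simp: blk_form_simps char2_simps power2_eq_square)
qed

text \<open>
  With \<open>e\<close> the unit vector, replace \<open>w\<close> by \<open>w + s e\<close> and \<open>e\<close> by \<open>e + s t w\<close>.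
\<close>

lemma blks_BU_BP: "{#BU, BP (s\<^sup>2)#} \<approx> ({#BU, BP 0#} :: 'k blk multiset)"
proof (rule blks_equiv_of_decomposes[OF decomposes_blk2 decomposes_blk2])
  show "blk_form BU \<boxplus> blk_form (BP (s\<^sup>2)) \<simeq> blk_form (BU :: 'k blk) \<boxplus> blk_form (BP 0)"
    by (rule form_isomorphicI[where
          \<phi> = "\<lambda>(((_, e), _), ((a, b), _)). (((0, e + s * a), (0, 0)), ((a, b + s * e), (0, 0)))"
          and \<psi> = "\<lambda>(((_, e), _), ((a, b), _)).
                 (((0, e + s * a), (0, 0)), ((a, b + s * e + s\<^sup>2 * a), (0, 0)))"])
      (auto simp: blk_form_simps char2_simps power2_eq_square)
qed

text \<open>
  The new generators are \<open>w\<^sub>1 + w\<^sub>2\<close>, \<open>(1 + t b) (w\<^sub>2 + w\<^sub>3)\<close> and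
  \<open>(1 + t a) w\<^sub>1 + (1 + t b) (w\<^sub>2 + w\<^sub>3)\<close>.
\<close>

lemma blks_BP_BP_BP: "{#BP a, BP b, BP b#} \<approx> ({#BQ (a + b), BP a#} :: 'k blk multiset)"
proof (rule blks_equiv_of_decomposes[OF decomposes_blk3 decomposes_blk2])
  show "blk_form (BP a) \<boxplus> (blk_form (BP b) \<boxplus> blk_form (BP b)) \<simeq>
      blk_form (BQ (a + b) :: 'k blk) \<boxplus> blk_form (BP a)"
    by (rule form_isomorphicI[where
          \<phi> = "\<lambda>(((e, e'), (f, f')), ((g, g'), _)).
             (((e + g, e' + g' + a * g), (0, 0)),
              ((e + f + g, e' + f' + g' + b * f + b * g), (0, 0)),
              ((f + g, f' + g' + b * f + b * g), (0, 0)))"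
          and \<psi> = "\<lambda>(((x, x'), _), ((y, y'), _), ((z, z'), _)).
             (((y + z, y' + z'), (x + y, x' + y' + a * x + b * y + (a + b) * (y + z))),
              ((x + y + z, x' + y' + z' + a * (x + y + z)), (0, 0)))"])
      (auto simp: blk_form_simps char2_simps)
qed

text \<open>
  If \<open>e\<^sub>i, f\<^sub>i\<close> generate the \<open>i\<close>-th block, the new generators are \<open>e\<^sub>1\<close>, \<open>f\<^sub>1 + f\<^sub>2\<close>,
  \<open>e\<^sub>1 + e\<^sub>2 + t (f\<^sub>1 + f\<^sub>2)\<close> and \<open>f\<^sub>2\<close>.
\<close>

lemma blks_BQ1_BQ1: "{#BQ 1, BQ 1#} \<approx> ({#BQ 1, BQ 0#} :: 'k blk multiset)"
proof (rule blks_equiv_of_decomposes[OF decomposes_blk2 decomposes_blk2])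
  show "blk_form (BQ 1) \<boxplus> blk_form (BQ 1) \<simeq> blk_form (BQ 1 :: 'k blk) \<boxplus> blk_form (BQ 0)"
    by (rule form_isomorphicI[where
          \<phi> = "\<lambda>(((a1, a1'), (b1, b1')), ((a2, a2'), (b2, b2'))).
             (((a1 + a2, a1' + a2'), (b1, b1' + a2)), ((a2, a2'), (b1 + b2, b1' + b2' + a2)))"
          and \<psi> = "\<lambda>(((x1, x1'), (y1, y1')), ((x2, x2'), (y2, y2'))).
             (((x1 + x2, x1' + x2'), (y1, y1' + x2)), ((x2, x2'), (y1 + y2, y1' + y2')))"])
      (auto simp: blk_form_simps char2_simps)
qed

text \<open>
  The new generators are \<open>p w\<^sub>1 + q w\<^sub>2\<close> and \<open>q (1 + t b) w\<^sub>1 + p (1 + t a) w\<^sub>2\<close>, where \<open>p + q = 1\<close> and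
  hence \<open>p\<^sup>2 (1 + t a) + q\<^sup>2 (1 + t b) = 1 + t c\<close> for \<open>c = b + p\<^sup>2 (a + b)\<close>.
\<close>

lemma blks_BP_BP:
  assumes "a \<noteq> b"
  shows "{#BP a, BP b#} \<approx> ({#BP c, BP (a + b + c)#} :: 'k blk multiset)"
proof -
  obtain p where p: "p ^ 2 = (b + c) / (a + b)"
    using nth_root_exists[of 2 "(b + c) / (a + b)"] by auto
  have "a + b \<noteq> 0"
    using assms char2_eq_iff by blast
  then have "p\<^sup>2 * (a + b) = b + c"
    using p by simp
  then have c: "c = b + p * p * (a + b)"
    by (metis char2_double_left power2_eq_square)
  show ?thesis
    unfolding c
  proof (rule blks_equiv_of_decomposes[OF decomposes_blk2 decomposes_blk2])
    define c where "c = b + p * p * (a + b)"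
    define q where "q = 1 + p"
    show "blk_form (BP a) \<boxplus> blk_form (BP b) \<simeq>
        blk_form (BP (b + p * p * (a + b))) \<boxplus> blk_form (BP (a + b + (b + p * p * (a + b))))"
      by (rule form_isomorphicI[where
            \<phi> = "\<lambda>(((f, f'), _), ((g, g'), _)).
               (((p * f + q * g, p * f' + q * g' + q * b * g), (0, 0)),
                ((q * f + p * g, q * f' + p * g' + p * a * g), (0, 0)))"
            \<comment> \<open>The coordinate of v along an orthogonal generator g is B(v, g) / B(g,
              g), where the inverse of 1 + t z is 1 + t z itself in characteristic 2.\<close>
            and \<psi> = "\<lambda>(((x, x'), _), ((y, y'), _)).
               (((p * x + q * y, p * x' + q * y' + p * (a + c) * x + q * (b + c) * y), (0, 0)),
                ((q * x + p * y, q * x' + p * y' + c * (q * x + p * y)), (0, 0)))"])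
        (auto simp: blk_form_simps char2_simps q_def c_def)
  qed
qed

text \<open>Taking b = a in \<open>blks_BP_BP_BP\<close> gives 3 P(a) = Q(0) + P(a), because a + a =
  0. Hence next to a \<open>BP a\<close> every \<open>BQ 0\<close> may be exchanged for two more
  copies of \<open>BP a\<close>.\<close>

lemma blks_BP_absorb:
  "add_mset (BP a) (replicate_mset j (BQ 0)) \<approx> (replicate_mset (Suc (2 * j)) (BP a) :: 'k blk multiset)"
proof (induction j)
  case 0
  show ?case by (simp add: blks_equiv_refl)
next
  case (Suc j)
  have "add_mset (BP a) (replicate_mset (Suc j) (BQ 0)) \<approx>
      add_mset (BQ 0) (replicate_mset (Suc (2 * j)) (BP a))"
    by (rule blks_equiv_context[OF Suc, of _ "{#BQ 0#}"]) (simp_all add: add_mset_commute)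
  also have "\<dots> \<approx> replicate_mset (Suc (2 * Suc j)) (BP a)"
    by (rule blks_equiv_context[OF blks_equiv_sym[OF blks_BP_BP_BP[of a a]],
          of _ "replicate_mset (2 * j) (BP a)"])
      (simp_all add: char2_double add_mset_commute)
  finally show ?case .
qed

text \<open>
  A unit block \<open>BU\<close> erases all invariants of the other blocks except for the dimensions and the
  presence of a block of type \<open>BP\<close>.
\<close>

lemma blks_BU_normal:
  "add_mset BU M \<approx> (replicate_mset (Suc (\<Sum>b\<in>#M. blk_dim1 b)) BU +
     (if \<exists>y. BP y \<in># M then replicate_mset (\<Sum>b\<in>#M. blk_dimP b) (BP 0)
      else replicate_mset ((\<Sum>b\<in>#M. blk_dimP b) div 2) (BQ 0)) :: 'k blk multiset)"
proof (induction M)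
  case empty
  show ?case by (simp add: blks_equiv_refl)
next
  case (add b M)
  define k where "k = (\<Sum>b\<in>#M. blk_dim1 b)"
  define d where "d = (\<Sum>b\<in>#M. blk_dimP b)"
  define R where "R = (if \<exists>y. BP y \<in># M then replicate_mset d (BP 0) else replicate_mset (d div 2) (BQ 0) :: 'k blk multiset)"
  \<comment> \<open>Without \<open>BP\<close> blocks the multiplicity of P is even, so nothing is
    lost in \<open>d div 2\<close>.\<close>
  have no_BP: "even d" if "\<not> (\<exists>y. BP y \<in># M)"
  proof -
    have "even (blk_dimP b)" if "b \<in># M" for b
      using that \<open>\<not> (\<exists>y. BP y \<in># M)\<close> by (cases b) auto
    then show ?thesis
      unfolding d_def by (induction M) auto
  qed
  have BP: "d > 0" if "BP y \<in># M" for y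
    using multi_member_split[OF that] by (auto simp: d_def)
  have "add_mset BU (add_mset b M) \<approx> add_mset b (replicate_mset (Suc k) BU + R)"
    by (rule blks_equiv_context[OF add.IH, of _ "{#b#}"]) (simp_all add: k_def d_def R_def add_mset_commute)
  also have "\<dots> \<approx> replicate_mset (Suc (blk_dim1 b + k)) BU +
      (if \<exists>y. BP y \<in># add_mset b M then replicate_mset (blk_dimP b + d) (BP 0)
       else replicate_mset ((blk_dimP b + d) div 2) (BQ 0))"
  proof (cases b)
    case BU
    then show ?thesis by (simp add: R_def blks_equiv_refl)
  next
    case BH
    show ?thesis
      by (rule blks_equiv_context[OF blks_BU_BH, of _ "replicate_mset k BU + R"])
        (auto simp: BH R_def add_mset_commute)
  next
    case b: (BP y)
    obtain s where s: "s\<^sup>2 = y"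
      using nth_root_exists[of 2 y] by auto
    have "add_mset b (replicate_mset (Suc k) BU + R) \<approx> add_mset (BP 0) (replicate_mset (Suc k) BU + R)"
      by (rule blks_equiv_context[OF blks_BU_BP[of s], of _ "replicate_mset k BU + R"])
        (auto simp: b s add_mset_commute)
    also have "\<dots> \<approx> replicate_mset (Suc k) BU + replicate_mset (Suc d) (BP 0)"
    proof (cases "\<exists>y. BP y \<in># M")
      case True
      then show ?thesis by (simp add: R_def blks_equiv_refl)
    next
      case False
      \<comment> \<open>The first \<open>BP\<close> block to arrive turns all the
        \<open>BQ 0\<close> collected so far into copies of \<open>BP 0\<close>.\<close>
      then show ?thesis
        by (intro blks_equiv_context[OF blks_BP_absorb[of 0 "d div 2"], of _ "replicate_mset (Suc k) BU"])
          (use no_BP in \<open>auto simp: R_def add_mset_commute\<close>)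
    qed
    finally show ?thesis
      by (auto simp: b add_mset_commute)
  next
    case b: (BQ y)
    obtain s where s: "s\<^sup>2 = y"
      using nth_root_exists[of 2 y] by auto
    have "add_mset b (replicate_mset (Suc k) BU + R) \<approx> add_mset (BQ 0) (replicate_mset (Suc k) BU + R)"
      by (rule blks_equiv_context[OF blks_BU_BQ[of s], of _ "replicate_mset k BU + R"])
        (auto simp: b s add_mset_commute)
    also have "\<dots> \<approx> replicate_mset (Suc k) BU +
      (if \<exists>y. BP y \<in># M then replicate_mset (2 + d) (BP 0) else replicate_mset ((2 + d) div 2) (BQ 0))"
    proof (cases "\<exists>y. BP y \<in># M")
      case True
      \<comment> \<open>A \<open>BP\<close> block in \<open>M\<close> makes \<open>d\<close>
        positive; one of the resulting \<open>BP 0\<close> absorbs the new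
        \<open>BQ 0\<close>.\<close>
      then obtain e where "d = Suc e"
        using BP gr0_implies_Suc by blast
      with True show ?thesis
        by (intro blks_equiv_context[OF blks_BP_absorb[of 0 1], of _ "replicate_mset (Suc k) BU + replicate_mset e (BP 0)"])
          (auto simp: R_def numeral_3_eq_3 add_mset_commute)
    next
      case False
      then show ?thesis
        by (simp add: R_def blks_equiv_refl)
    qed
    finally show ?thesis
      by (auto simp: b split: if_splits)
  qed
  finally show ?case
    by (simp only: k_def d_def image_mset_add_mset sum_mset.add_mset)
qed

lemma image_BP_pair:
  assumes "a \<noteq> b" "c + d = a + (b :: 'k)"
  shows "image_mset BP (add_mset a (add_mset b S)) \<approx> image_mset BP (add_mset c (add_mset d S))"
proof -
  have "a + b + c = d"
    using assms(2) char2_double_left[of c d] by (simp add: ac_simps)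
  then show ?thesis
    by (intro blks_equiv_context[OF blks_BP_BP[OF assms(1), of c], of _ "image_mset BP S"])
      (simp_all add: add_mset_commute)
qed

text \<open>Induction that takes in one label \<open>c\<close> at a time. After the induction
  hypothesis the labels are c, 1 + s, 1 and zeros, and the pair (c, 1 + s) may be replaced by (0, 1
  + c + s) if its members differ. The work lies in the case c = 1 + s.\<close>

lemma image_BP_nonconstant:
  assumes "a \<noteq> (b :: 'k)"
  shows "image_mset BP (add_mset a (add_mset b S)) \<approx>
    image_mset BP (add_mset 1 (add_mset (1 + (a + b + sum_mset S)) (replicate_mset (size S) 0)))"
proof (induction S)
  case empty
  show ?case
    using image_BP_pair[OF assms, of 1 "1 + (a + b)" "{#}"] by (simp add: char2_double_left)
next
  case (add c S)
  define k where "k = size S"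
  define s where "s = a + b + sum_mset S"
  \<comment> \<open>If \<open>S\<close> were empty, \<open>s\<close> would be a + b, which is
    nonzero for distinct labels. This guarantees a spare label 0 in the last case below.\<close>
  have s0: "k \<noteq> 0" if "s = 0"
    using that assms char2_eq_iff[of a b] by (auto simp: k_def s_def)
  let ?R = "replicate_mset k (0 :: 'k)"
  let ?N = "image_mset BP (add_mset 1 (add_mset (1 + (c + s)) (add_mset 0 ?R)))"
  have "image_mset BP (add_mset a (add_mset b (add_mset c S))) \<approx>
      image_mset BP (add_mset c (add_mset (1 + s) (add_mset 1 ?R)))"
    by (rule blks_equiv_context[OF add.IH, of _ "{#BP c#}"]) (simp_all add: k_def s_def add_mset_commute)
  also have "\<dots> \<approx> ?N"
  proof (cases "c = 1 + s")
    case False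
    then show ?thesis
      using image_BP_pair[of c "1 + s" 0 "1 + (c + s)" "add_mset 1 ?R"] by (simp add: add_mset_commute ac_simps)
  next
    case c: True
    have cs: "1 + (c + s) = 0"
      using c char2_double[of c] by (simp add: ac_simps)
    show ?thesis
    proof (cases "c = 1")
      case False
      \<comment> \<open>The labels are c, c, 1 and zeros: (c, 1) becomes (0, 1 + c), and then (1 +
        c, c) becomes (1, 0), as 1 + c always differs from c.\<close>
      have "image_mset BP (add_mset c (add_mset (1 + s) (add_mset 1 ?R))) \<approx>
          image_mset BP (add_mset (1 + c) (add_mset c (add_mset 0 ?R)))"
        using image_BP_pair[OF False, of 0 "1 + c" "add_mset c ?R"] c by (simp add: add_mset_commute ac_simps)
      also have "\<dots> \<approx> image_mset BP (add_mset 1 (add_mset 0 (add_mset 0 ?R)))"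
        by (rule image_BP_pair) (simp_all add: add.assoc char2_double)
      finally show ?thesis
        unfolding cs .
    next
      case c1: True
      \<comment> \<open>The labels \<open>1, 1, 1, 0\<close>: the pair \<open>1, 1\<close> is turned into \<open>0, 0\<close> by way of \<open>BQ 0\<close>.\<close>
      then have "s = 0"
        using c by simp
      then obtain j where k: "k = Suc j"
        using s0 not0_implies_Suc by blast
      let ?J = "image_mset BP (replicate_mset j (0 :: 'k))"
      have "image_mset BP (add_mset c (add_mset (1 + s) (add_mset 1 ?R))) \<approx>
          add_mset (BQ 0) (add_mset (BP 1) (add_mset (BP 0) ?J))"
        by (rule blks_equiv_context[OF blks_BP_BP_BP[of 1 1], of _ "add_mset (BP 0) ?J"])
          (simp_all add: c1 \<open>s = 0\<close> k char2_two add_mset_commute)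
      also have "\<dots> \<approx> image_mset BP (add_mset 1 (add_mset 0 (add_mset 0 ?R)))"
        by (rule blks_equiv_context[OF blks_equiv_sym[OF blks_BP_BP_BP[of 0 0]],
              of _ "add_mset (BP 1) ?J"])
          (simp_all add: k add_mset_commute)
      finally show ?thesis
        unfolding cs .
    qed
  qed
  finally show ?case
    by (simp add: k_def s_def ac_simps)
qed

text \<open>Each \<open>BQ 0\<close> is first exchanged for two blocks with the label
  \<open>a\<close>, an even number of copies that leaves the sum of the labels unchanged. The last
  two claims are the side conditions of class F; the pair (0, 2) is excluded since two distinct
  labels have nonzero sum.\<close>

lemma blks_nonconstant:
  assumes "a \<in># S" "b \<in># S" "a \<noteq> (b :: 'k)"
  shows "replicate_mset j (BQ 0) + image_mset BP S \<approx>
    replicate_mset (size S + 2 * j - 2) (BP 0) + {#BP 1#} + {#BP (1 + sum_mset S)#}"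
    and "size S + 2 * j \<ge> 2" and "(sum_mset S, size S + 2 * j) \<noteq> (0, 2)"
proof -
  obtain T where T: "S = add_mset a (add_mset b T)"
    by (metis assms insert_noteq_member multi_member_split)
  let ?T = "T + replicate_mset (2 * j) a"
  have sum: "sum_mset ?T = sum_mset T"
    by (simp add: char2_two sum_mset_replicate_mset)
  have "replicate_mset j (BQ 0) + image_mset BP S \<approx> image_mset BP (add_mset a (add_mset b ?T))"
    by (rule blks_equiv_context[OF blks_BP_absorb[of a j], of _ "image_mset BP (add_mset b T)"])
      (simp_all add: T add_mset_commute)
  also have "\<dots> \<approx> image_mset BP (add_mset 1 (add_mset (1 + (a + b + sum_mset ?T)) (replicate_mset (size ?T) 0)))"
    by (rule image_BP_nonconstant) fact
  also have "image_mset BP (add_mset 1 (add_mset (1 + (a + b + sum_mset ?T)) (replicate_mset (size ?T) 0))) =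
      replicate_mset (size S + 2 * j - 2) (BP 0) + {#BP 1#} + {#BP (1 + sum_mset S)#}"
    unfolding sum by (simp add: T add_mset_commute add.assoc)
  finally show "replicate_mset j (BQ 0) + image_mset BP S \<approx>
    replicate_mset (size S + 2 * j - 2) (BP 0) + {#BP 1#} + {#BP (1 + sum_mset S)#}" .
  show "size S + 2 * j \<ge> 2"
    by (simp add: T)
  have "T = {#}" if "size S + 2 * j = 2"
    using that by (simp add: T)
  then show "(sum_mset S, size S + 2 * j) \<noteq> (0, 2)"
    using assms(3) char2_eq_iff[of a b] by (auto simp: T)
qed

text \<open>All rows with A or B at once: a block \<open>BU\<close> is present, and the blocks of
  \<open>Z\<close> are exactly the normal form of \<open>blks_BU_normal\<close> for the given
  multiplicities.\<close>

lemma class_sum_AB: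
  assumes "X \<in> {ClassA, ClassB :: 'k form_class} \<or> Y \<in> {ClassA, ClassB}"
    and "Z = (if has_BP X \<or> has_BP Y then ClassB else ClassA)"
  shows "class_sum_ok X m n Y p q Z"
  unfolding class_sum_ok_def
proof (intro impI)
  assume ok: "class_ok X m n" "class_ok Y p q"
  let ?M = "class_blks X m n + class_blks Y p q"
  have BP_iff: "(\<exists>y. BP y \<in># ?M) \<longleftrightarrow> has_BP X \<or> has_BP Y"
    using class_blks_dims(3)[OF ok(1)] class_blks_dims(3)[OF ok(2)] by auto
  have even: "even n" if "\<not> has_BP X"
    using ok that by (cases X) (auto simp: has_BP_def)
  have even': "even q" if "\<not> has_BP Y"
    using ok that by (cases Y) (auto simp: has_BP_def)
  have pos: "n + q > 0" if "has_BP X \<or> has_BP Y"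
    using ok that by (auto simp: has_BP_def)
  have "BU \<in># ?M" "m + p > 0"
    using assms(1) ok by auto
  then obtain N where N: "?M = add_mset BU N"
    by (metis multi_member_split)
  have dims: "Suc (\<Sum>b\<in>#N. blk_dim1 b) = m + p" "(\<Sum>b\<in>#N. blk_dimP b) = n + q"
    using arg_cong[OF N, of "\<lambda>M. \<Sum>b\<in>#M. blk_dim1 b"] arg_cong[OF N, of "\<lambda>M. \<Sum>b\<in>#M. blk_dimP b"]
      class_blks_dims[OF ok(1)] class_blks_dims[OF ok(2)] by simp_all
  have BP_N: "(\<exists>y. BP y \<in># N) \<longleftrightarrow> has_BP X \<or> has_BP Y"
    using BP_iff unfolding N by simp
  have "?M \<approx> class_blks Z (m + p) (n + q)"
    unfolding N assms(2) using blks_BU_normal[of N, unfolded dims BP_N] by (auto split: if_splits)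
  then show "class_ok Z (m + p) (n + q) \<and> ?M \<approx> class_blks Z (m + p) (n + q)"
    using assms(2) \<open>m + p > 0\<close> even even' pos by auto
qed

text \<open>Recognition of class F: as soon as two labels differ, only the number of blocks and the
  sum of the labels matter.\<close>

lemma class_F_I:
  assumes "a \<in># S" "b \<in># S" "a \<noteq> (b :: 'k)" "even m" "n = size S + 2 * j" "sum_mset S = s"
  shows "class_ok (ClassF s) m n"
    and "replicate_mset (m div 2) BH + (replicate_mset j (BQ 0) + image_mset BP S) \<approx> class_blks (ClassF s) m n"
  using blks_nonconstant(2,3)[OF assms(1-3), of j] assms(4-6)
    blks_equiv_add_left[OF blks_nonconstant(1)[OF assms(1-3), of j], of "replicate_mset (m div 2) BH"]
  by auto

text \<open>Conversely, the normal form of class F never has constant labels: next to 1 there is a 0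
  if n > 2, and for n = 2 the label 1 + a differs from 1 because a = 0 is excluded.\<close>

lemma F_labels:
  assumes "class_ok (ClassF (a :: 'k)) m n"
  shows "class_blks (ClassF a) m n = replicate_mset (m div 2) BH + image_mset BP (F_labels a n)"
    and "\<exists>b\<in>#F_labels a n. b \<noteq> 1"
    and "1 \<in># F_labels a n" and "size (F_labels a n) = n" and "sum_mset (F_labels a n) = a"
proof -
  show "\<exists>b\<in>#F_labels a n. b \<noteq> 1"
    using assms by (cases "n = 2") (auto simp: F_labels_def)
qed (use assms in \<open>auto simp: F_labels_def char2_double_left\<close>)

section \<open>The rows among C, D, E and F that use relations between blocks\<close>

lemma class_sum_DD: "class_sum_ok ClassD m n ClassD p q (ClassD :: 'k form_class)"
  unfolding class_sum_ok_def
proof (intro impI)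
  assume ok: "class_ok (ClassD :: 'k form_class) m n" "class_ok (ClassD :: 'k form_class) p q"
  then obtain i j k l where "m = 2 * i" "p = 2 * j" "n = 2 * Suc k" "q = 2 * Suc l"
    by (auto elim!: even_ge_2E evenE[of m] evenE[of p])
  then show "class_ok (ClassD :: 'k form_class) (m + p) (n + q) \<and>
      class_blks ClassD m n + class_blks ClassD p q \<approx> (class_blks ClassD (m + p) (n + q) :: 'k blk multiset)"
    by (auto intro!: blks_equiv_context[OF blks_BQ1_BQ1,
          of _ "replicate_mset (i + j) BH + replicate_mset (k + l) (BQ 0)"]
        simp: replicate_mset_add ac_simps)
qed

text \<open>Since n > 0, there is a block \<open>BP a\<close> that absorbs the \<open>BQ 0\<close>
  of the other summand.\<close>

lemma class_sum_EC: "class_sum_ok (ClassE (a :: 'k)) m n ClassC p q (ClassE a)"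
  unfolding class_sum_ok_def
proof (intro impI)
  assume ok: "class_ok (ClassE a) m n" "class_ok (ClassC :: 'k form_class) p q"
  then obtain i j k l where "m = 2 * i" "p = 2 * j" "n = Suc k" "q = 2 * l"
    by (auto elim!: evenE dest: gr0_implies_Suc)
  then show "class_ok (ClassE a) (m + p) (n + q) \<and>
      class_blks (ClassE a) m n + class_blks ClassC p q \<approx> class_blks (ClassE a) (m + p) (n + q)"
    by (auto intro!: blks_equiv_context[OF blks_BP_absorb[of a l],
          of _ "replicate_mset (i + j) BH + replicate_mset k (BP a)"]
        simp: replicate_mset_add ac_simps)
qed

lemma class_sum_FC: "class_sum_ok (ClassF (a :: 'k)) m n ClassC p q (ClassF a)"
  unfolding class_sum_ok_def
proof (intro impI)
  assume ok: "class_ok (ClassF a) m n" "class_ok (ClassC :: 'k form_class) p q"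
  note F = F_labels[OF ok(1)]
  obtain b where b: "b \<in># F_labels a n" "b \<noteq> 1"
    using F(2) by blast
  have "class_blks (ClassF a) m n + class_blks ClassC p q = replicate_mset ((m + p) div 2) BH +
      (replicate_mset (q div 2) (BQ 0) + image_mset BP (F_labels a n))"
    using ok unfolding F(1) by (simp add: div_plus_div_distrib_dvd_left replicate_mset_add ac_simps)
  then show "class_ok (ClassF a) (m + p) (n + q) \<and>
      class_blks (ClassF a) m n + class_blks ClassC p q \<approx> class_blks (ClassF a) (m + p) (n + q)"
    using class_F_I[OF b(1) F(3) b(2), of "m + p" "n + q" "q div 2" a] F(4,5) ok by (simp del: class_blks.simps)
qed

text \<open>Since x + (1 + x) = 1, the block \<open>BQ 1\<close> next to \<open>BP x\<close> can be
  exchanged for two blocks \<open>BP (1 + x)\<close>. Their label differs from \<open>x\<close>,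
  which leads to class F even when \<open>S\<close> is constant, and the two copies cancel in the
  sum.\<close>

lemma class_D_I:
  assumes "(x :: 'k) \<in># S" "even m" "n = size S + 2 * j + 2" "sum_mset S = s"
  shows "class_ok (ClassF s) m n"
    and "replicate_mset (m div 2) BH + (add_mset (BQ 1) (replicate_mset j (BQ 0)) + image_mset BP S)
      \<approx> class_blks (ClassF s) m n"
proof -
  obtain T where S: "S = add_mset x T"
    using assms(1) by (metis multi_member_split)
  let ?S = "S + {#1 + x, 1 + x#}"
  have x: "x + (1 + x) = 1"
    using char2_double_left[of x 1] by (simp add: ac_simps)
  have F: "x \<in># ?S" "1 + x \<in># ?S" "x \<noteq> 1 + x" "even m" "n = size ?S + 2 * j" "sum_mset ?S = s"
    using assms by (simp_all add: char2_two)
  show "class_ok (ClassF s) m n"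
    by (rule class_F_I(1)[OF F])
  have "replicate_mset (m div 2) BH + (add_mset (BQ 1) (replicate_mset j (BQ 0)) + image_mset BP S)
      \<approx> replicate_mset (m div 2) BH + (replicate_mset j (BQ 0) + image_mset BP ?S)"
    by (rule blks_equiv_context[OF blks_equiv_sym[OF blks_BP_BP_BP[of x "1 + x"], unfolded x],
          of _ "replicate_mset (m div 2) BH + (replicate_mset j (BQ 0) + image_mset BP T)"])
      (simp_all add: S add_mset_commute)
  also have "\<dots> \<approx> class_blks (ClassF s) m n"
    by (rule class_F_I(2)[OF F])
  finally show "replicate_mset (m div 2) BH + (add_mset (BQ 1) (replicate_mset j (BQ 0)) + image_mset BP S)
      \<approx> class_blks (ClassF s) m n" .
qed

lemma class_sum_ED: "class_sum_ok (ClassE (a :: 'k)) m n ClassD p q (ClassF (of_nat n * a))"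
  unfolding class_sum_ok_def
proof (intro impI)
  assume ok: "class_ok (ClassE a) m n" "class_ok (ClassD :: 'k form_class) p q"
  have "class_blks (ClassE a) m n + class_blks ClassD p q = replicate_mset ((m + p) div 2) BH +
      (add_mset (BQ 1) (replicate_mset ((q - 2) div 2) (BQ 0)) + image_mset BP (replicate_mset n a))"
    using ok by (simp add: div_plus_div_distrib_dvd_left replicate_mset_add ac_simps)
  moreover have "n + q = size (replicate_mset n a) + 2 * ((q - 2) div 2) + 2"
    using ok by (auto elim: even_ge_2E)
  ultimately show "class_ok (ClassF (of_nat n * a)) (m + p) (n + q) \<and>
      class_blks (ClassE a) m n + class_blks ClassD p q \<approx> class_blks (ClassF (of_nat n * a)) (m + p) (n + q)"
    using class_D_I[of a "replicate_mset n a" "m + p" "n + q" "(q - 2) div 2" "of_nat n * a"] ok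
    by (simp del: class_blks.simps)
qed

lemma class_sum_FD: "class_sum_ok (ClassF (a :: 'k)) m n ClassD p q (ClassF a)"
  unfolding class_sum_ok_def
proof (intro impI)
  assume ok: "class_ok (ClassF a) m n" "class_ok (ClassD :: 'k form_class) p q"
  note F = F_labels[OF ok(1)]
  have "class_blks (ClassF a) m n + class_blks ClassD p q = replicate_mset ((m + p) div 2) BH +
      (add_mset (BQ 1) (replicate_mset ((q - 2) div 2) (BQ 0)) + image_mset BP (F_labels a n))"
    using ok unfolding F(1) by (simp add: div_plus_div_distrib_dvd_left replicate_mset_add ac_simps)
  moreover have "n + q = size (F_labels a n) + 2 * ((q - 2) div 2) + 2"
    using ok F(4) by (auto elim: even_ge_2E)
  ultimately show "class_ok (ClassF a) (m + p) (n + q) \<and>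
      class_blks (ClassF a) m n + class_blks ClassD p q \<approx> class_blks (ClassF a) (m + p) (n + q)"
    using class_D_I[OF F(3), of "m + p" "n + q" "(q - 2) div 2" a] F(4,5) ok by (simp del: class_blks.simps)
qed

lemma class_sum_EE:
  assumes "a \<noteq> (b :: 'k)"
  shows "class_sum_ok (ClassE a) m n (ClassE b) p q (ClassF (of_nat n * a + of_nat q * b))"
  unfolding class_sum_ok_def
proof (intro impI)
  assume ok: "class_ok (ClassE a) m n" "class_ok (ClassE b) p q"
  let ?S = "replicate_mset n a + replicate_mset q b" and ?s = "of_nat n * a + of_nat q * b"
  \<comment> \<open>The empty multiset \<open>replicate_mset 0 (BQ 0)\<close> brings the sum into
    the shape of \<open>class_F_I\<close> with j = 0.\<close>
  have "class_blks (ClassE a) m n + class_blks (ClassE b) p q = replicate_mset ((m + p) div 2) BH +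
      (replicate_mset 0 (BQ 0) + image_mset BP ?S)"
    using ok by (simp add: div_plus_div_distrib_dvd_left replicate_mset_add ac_simps)
  then show "class_ok (ClassF ?s) (m + p) (n + q) \<and>
      class_blks (ClassE a) m n + class_blks (ClassE b) p q \<approx> class_blks (ClassF ?s) (m + p) (n + q)"
    using class_F_I[of a ?S b "m + p" "n + q" 0 ?s] assms ok by (simp del: class_blks.simps)
qed

text \<open>The summand in F already supplies the distinct labels 1 and \<open>c\<close>, so no
  comparison with \<open>b\<close> arises.\<close>

lemma class_sum_FE: "class_sum_ok (ClassF (a :: 'k)) m n (ClassE b) p q (ClassF (a + of_nat q * b))"
  unfolding class_sum_ok_def
proof (intro impI)
  assume ok: "class_ok (ClassF a) m n" "class_ok (ClassE b) p q"
  note F = F_labels[OF ok(1)]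
  obtain c where c: "c \<in># F_labels a n" "c \<noteq> 1"
    using F(2) by blast
  let ?S = "F_labels a n + replicate_mset q b"
  have "class_blks (ClassF a) m n + class_blks (ClassE b) p q = replicate_mset ((m + p) div 2) BH +
      (replicate_mset 0 (BQ 0) + image_mset BP ?S)"
    using ok unfolding F(1) by (simp add: div_plus_div_distrib_dvd_left replicate_mset_add ac_simps)
  then show "class_ok (ClassF (a + of_nat q * b)) (m + p) (n + q) \<and>
      class_blks (ClassF a) m n + class_blks (ClassE b) p q \<approx> class_blks (ClassF (a + of_nat q * b)) (m + p) (n + q)"
    using class_F_I[of c ?S 1 "m + p" "n + q" 0 "a + of_nat q * b"] F(3-5) c ok by (simp del: class_blks.simps)
qed

lemma class_sum_FF: "class_sum_ok (ClassF (a :: 'k)) m n (ClassF b) p q (ClassF (a + b))"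
  unfolding class_sum_ok_def
proof (intro impI)
  assume ok: "class_ok (ClassF a) m n" "class_ok (ClassF b) p q"
  note F = F_labels[OF ok(1)] and F' = F_labels[OF ok(2)]
  obtain c where c: "c \<in># F_labels a n" "c \<noteq> 1"
    using F(2) by blast
  let ?S = "F_labels a n + F_labels b q"
  have "class_blks (ClassF a) m n + class_blks (ClassF b) p q = replicate_mset ((m + p) div 2) BH +
      (replicate_mset 0 (BQ 0) + image_mset BP ?S)"
    using ok unfolding F(1) F'(1) by (simp add: div_plus_div_distrib_dvd_left replicate_mset_add ac_simps)
  then show "class_ok (ClassF (a + b)) (m + p) (n + q) \<and>
      class_blks (ClassF a) m n + class_blks (ClassF b) p q \<approx> class_blks (ClassF (a + b)) (m + p) (n + q)"
    using class_F_I[of c ?S 1 "m + p" "n + q" 0 "a + b"] F(3-5) F'(4,5) c ok by (simp del: class_blks.simps)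
qed

end

section \<open>Sums of objects and non-degeneracy\<close>

lemma ver4_obj_sum:
  assumes U: "ver4_obj U" and V: "ver4_obj V"
  shows "ver4_obj (obj_sum U V)"
proof -
  interpret U: vector_space "vscale U" using U by (simp add: ver4_obj_def)
  interpret V: vector_space "vscale V" using V by (simp add: ver4_obj_def)
  let ?s = "vscale (obj_sum U V)"
  have s: "?s c (u, v) = (vscale U c u, vscale V c v)" for c u v
    by (simp add: obj_sum_def)
  interpret W: vector_space ?s
    by unfold_locales
      (auto simp: s U.scale_left_distrib U.scale_right_distrib V.scale_left_distrib V.scale_right_distrib)
  have sub: "U.subspace (vcar U)" "V.subspace (vcar V)"
    using U V by (simp_all add: ver4_obj_def)
  have W_sub: "W.subspace (vcar U \<times> vcar V)"
    using sub by (auto simp: W.subspace_def U.subspace_def V.subspace_def s zero_prod_def)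
  obtain B C where B: "finite B" "U.span B = vcar U" and C: "finite C" "V.span C = vcar V"
    using U V by (auto simp: ver4_obj_def)
  let ?D = "(\<lambda>u. (u, 0)) ` B \<union> (\<lambda>v. (0, v)) ` C"
  have left: "(u, 0) \<in> W.span ?D" if "u \<in> U.span B" for u
    using that
  proof (induction rule: U.span_induct_alt)
    case base
    show ?case using W.span_zero[of ?D] by (simp add: zero_prod_def)
  next
    case (step c x y)
    have "?s c (x, 0) + (y, 0) \<in> W.span ?D"
      by (intro W.span_add W.span_scale W.span_base step) (use step in auto)
    then show ?case by (simp add: s)
  qed
  have right: "(0, v) \<in> W.span ?D" if "v \<in> V.span C" for v
    using that
  proof (induction rule: V.span_induct_alt)
    case base
    show ?case using W.span_zero[of ?D] by (simp add: zero_prod_def)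
  next
    case (step c x y)
    have "?s c (0, x) + (0, y) \<in> W.span ?D"
      by (intro W.span_add W.span_scale W.span_base step) (use step in auto)
    then show ?case by (simp add: s)
  qed
  have "W.span ?D = vcar U \<times> vcar V"
  proof (intro equalityI subsetI)
    have "?D \<subseteq> vcar U \<times> vcar V"
      using B C U.span_superset[of B] V.span_superset[of C] U.span_zero[of B] V.span_zero[of C] by auto
    then show "w \<in> vcar U \<times> vcar V" if "w \<in> W.span ?D" for w
      using W.span_minimal[OF _ W_sub] that by blast
  next
    fix w assume "w \<in> vcar U \<times> vcar V"
    then obtain u v where "w = (u, 0) + (0, v)" "u \<in> vcar U" "v \<in> vcar V"
      by auto
    then show "w \<in> W.span ?D"
      using W.span_add left right B C by metis
  qed
  moreover have "finite ?D"
    using B C by simp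
  ultimately have "\<exists>D. finite D \<and> W.span D = vcar (obj_sum U V)"
    by (auto simp: obj_sum_def)
  moreover have "klinear (obj_sum U V) (obj_sum U V) (vact (obj_sum U V))"
    "\<forall>w\<in>vcar (obj_sum U V). vact (obj_sum U V) (vact (obj_sum U V) w) = 0"
    using U V by (auto simp: ver4_obj_def klinear_def obj_sum_def zero_prod_def)
  ultimately show ?thesis
    unfolding ver4_obj_def using W.vector_space_axioms W_sub by (auto simp: obj_sum_def)
qed

lemma bilinear_formD:
  assumes "bilinear_form \<beta>"
  shows "ver4_obj (fobj \<beta>)"
    and "\<And>u. u \<in> vcar (fobj \<beta>) \<Longrightarrow> klinear (fobj \<beta>) obj_unit (\<lambda>u'. fval \<beta> u u')"
    and "\<And>u. u \<in> vcar (fobj \<beta>) \<Longrightarrow> klinear (fobj \<beta>) obj_unit (\<lambda>u'. fval \<beta> u' u)"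
    and "\<And>u u'. u \<in> vcar (fobj \<beta>) \<Longrightarrow> u' \<in> vcar (fobj \<beta>) \<Longrightarrow>
          fval \<beta> (vact (fobj \<beta>) u) u' + fval \<beta> u (vact (fobj \<beta>) u') = 0"
  using assms by (auto simp: bilinear_form_def Let_def)

lemma klinear_unit_iff:
  "klinear U obj_unit f \<longleftrightarrow>
     (\<forall>u\<in>vcar U. \<forall>u'\<in>vcar U. f (u + u') = f u + f u') \<and> (\<forall>c. \<forall>u\<in>vcar U. f (vscale U c u) = c * f u)"
  by (simp add: klinear_def obj_unit_def)

lemma ver4_obj_zero_in: "ver4_obj U \<Longrightarrow> 0 \<in> vcar U"
  by (auto simp: ver4_obj_def module.subspace_def vector_space_def module_iff_vector_space)

lemma bilinear_form_sum:
  assumes \<beta>: "bilinear_form \<beta>" and \<gamma>: "bilinear_form \<gamma>"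
  shows "bilinear_form (\<beta> \<boxplus> \<gamma>)"
proof -
  have "ver4_obj (fobj (\<beta> \<boxplus> \<gamma>))"
    using ver4_obj_sum[OF bilinear_formD(1)[OF \<beta>] bilinear_formD(1)[OF \<gamma>]] by (simp add: form_sum_def)
  moreover have "fval \<beta> (vact (fobj \<beta>) u) u' + fval \<gamma> (vact (fobj \<gamma>) v) v' +
      (fval \<beta> u (vact (fobj \<beta>) u') + fval \<gamma> v (vact (fobj \<gamma>) v')) = 0"
    if "u \<in> vcar (fobj \<beta>)" "u' \<in> vcar (fobj \<beta>)" "v \<in> vcar (fobj \<gamma>)" "v' \<in> vcar (fobj \<gamma>)" for u u' v v'
    using bilinear_formD(4)[OF \<beta> that(1,2)] bilinear_formD(4)[OF \<gamma> that(3,4)]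
    by (metis (no_types, lifting) add.assoc add.commute add.right_neutral)
  ultimately show ?thesis
    using bilinear_formD(2,3)[OF \<beta>] bilinear_formD(2,3)[OF \<gamma>]
    by (auto simp: bilinear_form_def Let_def klinear_unit_iff algebra_simps)
qed

lemma symmetric_form_sum:
  assumes "symmetric_form \<beta>" "symmetric_form \<gamma>"
  shows "symmetric_form (\<beta> \<boxplus> \<gamma>)"
proof -
  have "fval \<beta> u' u + fval \<gamma> v' v +
      (fval \<beta> (vact (fobj \<beta>) u') (vact (fobj \<beta>) u) + fval \<gamma> (vact (fobj \<gamma>) v') (vact (fobj \<gamma>) v)) =
      fval \<beta> u u' + fval \<gamma> v v'"
    if "u \<in> vcar (fobj \<beta>)" "u' \<in> vcar (fobj \<beta>)" "v \<in> vcar (fobj \<gamma>)" "v' \<in> vcar (fobj \<gamma>)" for u u' v v'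
  proof -
    have "fval \<beta> u u' = fval \<beta> u' u + fval \<beta> (vact (fobj \<beta>) u') (vact (fobj \<beta>) u)"
      "fval \<gamma> v v' = fval \<gamma> v' v + fval \<gamma> (vact (fobj \<gamma>) v') (vact (fobj \<gamma>) v)"
      using assms that by (simp_all add: symmetric_form_def Let_def)
    then show ?thesis
      by (simp only: ac_simps)
  qed
  then show ?thesis
    by (auto simp: symmetric_form_def Let_def)
qed

abbreviation dual_map :: "('k::field, 'v::ab_group_add) vform \<Rightarrow> 'v \<Rightarrow> 'v \<Rightarrow> 'k" where
  "dual_map \<beta> u u' \<equiv> if u' \<in> vcar (fobj \<beta>) then fval \<beta> u u' else 0"

text \<open>Compatibility with t is the invariance clause of \<open>bilinear_form\<close>, the sign
  being that of the antipode in \<open>obj_dual\<close>. Non-degeneracy thereby reduces to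
  bijectivity.\<close>

lemma dual_map_hom:
  assumes "bilinear_form \<beta>"
  shows "ver4_hom (fobj \<beta>) (obj_dual (fobj \<beta>)) (dual_map \<beta>)"
proof -
  note \<beta> = bilinear_formD[OF assms, unfolded klinear_unit_iff]
  interpret U: vector_space "vscale (fobj \<beta>)"
    using \<beta>(1) by (simp add: ver4_obj_def)
  have closed: "u + u' \<in> vcar (fobj \<beta>)" "vscale (fobj \<beta>) c u \<in> vcar (fobj \<beta>)" "vact (fobj \<beta>) u \<in> vcar (fobj \<beta>)"
    if "u \<in> vcar (fobj \<beta>)" "u' \<in> vcar (fobj \<beta>)" for c u u'
    using \<beta>(1) that by (auto simp: ver4_obj_def klinear_def U.subspace_def)
  have "fval \<beta> (vact (fobj \<beta>) u) u' = - fval \<beta> u (vact (fobj \<beta>) u')"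
    if "u \<in> vcar (fobj \<beta>)" "u' \<in> vcar (fobj \<beta>)" for u u'
    using \<beta>(4)[OF that] by (simp add: eq_neg_iff_add_eq_0)
  then show ?thesis
    unfolding ver4_hom_def klinear_def[where f = "dual_map \<beta>"]
    using \<beta>(2,3) closed by (auto simp: obj_dual_def klinear_unit_iff fun_eq_iff)
qed

lemma dual_map_in_dual:
  assumes "bilinear_form \<beta>" "u \<in> vcar (fobj \<beta>)"
  shows "dual_map \<beta> u \<in> vcar (obj_dual (fobj \<beta>))"
proof -
  have "dual_map \<beta> ` vcar (fobj \<beta>) \<subseteq> vcar (obj_dual (fobj \<beta>))"
    using dual_map_hom[OF assms(1)] unfolding ver4_hom_def klinear_def by (elim conjE)
  then show ?thesis
    using assms(2) by (rule subsetD[OF _ imageI])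
qed

lemma nondegenerate_form_iff:
  assumes "bilinear_form \<beta>"
  shows "nondegenerate_form \<beta> \<longleftrightarrow> bij_betw (dual_map \<beta>) (vcar (fobj \<beta>)) (vcar (obj_dual (fobj \<beta>)))"
  using dual_map_hom[OF assms] by (simp add: nondegenerate_form_def ver4_iso_def Let_def)

lemma fval_zero:
  assumes "bilinear_form \<beta>" "u \<in> vcar (fobj \<beta>)"
  shows "fval \<beta> u 0 = 0"
  using bilinear_formD(2)[OF assms] ver4_obj_zero_in[OF bilinear_formD(1)[OF assms(1)]]
  by (force simp: klinear_unit_iff)

text \<open>A functional on a direct sum is determined by its restrictions to the summands, and
  these can be prescribed independently. Testing against the vectors (x, 0) and (0, y) therefore
  gives injectivity and surjectivity from those of the two summands.\<close>

lemma nondegenerate_form_sum: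
  assumes \<beta>: "bilinear_form \<beta>" "nondegenerate_form \<beta>" and \<gamma>: "bilinear_form \<gamma>" "nondegenerate_form \<gamma>"
  shows "nondegenerate_form (\<beta> \<boxplus> \<gamma>)"
proof -
  let ?U = "fobj \<beta>" and ?V = "fobj \<gamma>" and ?W = "fobj (\<beta> \<boxplus> \<gamma>)"
  have bij: "bij_betw (dual_map \<beta>) (vcar ?U) (vcar (obj_dual ?U))"
    "bij_betw (dual_map \<gamma>) (vcar ?V) (vcar (obj_dual ?V))"
    using \<beta> \<gamma> by (simp_all add: nondegenerate_form_iff)
  have zero: "0 \<in> vcar ?U" "0 \<in> vcar ?V"
    using bilinear_formD(1) ver4_obj_zero_in \<beta>(1) \<gamma>(1) by blast+
  have "inj_on (dual_map (\<beta> \<boxplus> \<gamma>)) (vcar ?W)"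
  proof (rule inj_onI)
    fix w w' assume w: "w \<in> vcar ?W" "w' \<in> vcar ?W" and eq: "dual_map (\<beta> \<boxplus> \<gamma>) w = dual_map (\<beta> \<boxplus> \<gamma>) w'"
    obtain u v u' v' where uv: "w = (u, v)" "w' = (u', v')" "u \<in> vcar ?U" "u' \<in> vcar ?U" "v \<in> vcar ?V" "v' \<in> vcar ?V"
      using w by auto
    have "dual_map \<beta> u = dual_map \<beta> u'"
    proof
      fix x show "dual_map \<beta> u x = dual_map \<beta> u' x"
        using fun_cong[OF eq, of "(x, 0)"] uv zero fval_zero[OF \<gamma>(1)] by (auto split: if_splits)
    qed
    then have "u = u'"
      using inj_onD[OF bij_betw_imp_inj_on[OF bij(1)]] uv by blast
    have "dual_map \<gamma> v = dual_map \<gamma> v'"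
    proof
      fix x show "dual_map \<gamma> v x = dual_map \<gamma> v' x"
        using fun_cong[OF eq, of "(0, x)"] uv zero fval_zero[OF \<beta>(1)] by (auto split: if_splits)
    qed
    then have "v = v'"
      using inj_onD[OF bij_betw_imp_inj_on[OF bij(2)]] uv by blast
    with \<open>u = u'\<close> show "w = w'"
      using uv by simp
  qed
  moreover have "dual_map (\<beta> \<boxplus> \<gamma>) ` vcar ?W = vcar (obj_dual ?W)"
  proof (intro equalityI subsetI)
    fix f assume "f \<in> dual_map (\<beta> \<boxplus> \<gamma>) ` vcar ?W"
    moreover have "dual_map (\<beta> \<boxplus> \<gamma>) w \<in> vcar (obj_dual ?W)" if "w \<in> vcar ?W" for w
      using dual_map_in_dual[OF bilinear_form_sum[OF \<beta>(1) \<gamma>(1)] that] .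
    ultimately show "f \<in> vcar (obj_dual ?W)"
      by blast
  next
    fix f assume f: "f \<in> vcar (obj_dual ?W)"
    then have f_add: "f (u + u', v + v') = f (u, v) + f (u', v')"
      if "u \<in> vcar ?U" "u' \<in> vcar ?U" "v \<in> vcar ?V" "v' \<in> vcar ?V" for u u' v v'
      using that by (auto simp: obj_dual_def klinear_unit_iff)
    have f_scale: "f (vscale ?U c u, vscale ?V c v) = c * f (u, v)"
      if "u \<in> vcar ?U" "v \<in> vcar ?V" for c u v
      using f that by (auto simp: obj_dual_def klinear_unit_iff)
    have f_0: "f (u, v) = 0" if "u \<notin> vcar ?U \<or> v \<notin> vcar ?V" for u v
      using f that by (auto simp: obj_dual_def)
    interpret U: vector_space "vscale ?U"
      using bilinear_formD(1)[OF \<beta>(1)] by (simp add: ver4_obj_def)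
    interpret V: vector_space "vscale ?V"
      using bilinear_formD(1)[OF \<gamma>(1)] by (simp add: ver4_obj_def)
    have "(\<lambda>u. f (u, 0)) \<in> vcar (obj_dual ?U)"
      using f_add[of _ _ 0 0] f_scale[of _ 0] f_0 zero
      by (auto simp: obj_dual_def klinear_unit_iff)
    then obtain u where u: "u \<in> vcar ?U" "dual_map \<beta> u = (\<lambda>u. f (u, 0))"
      using bij(1) by (metis (no_types, lifting) bij_betw_def imageE)
    have "(\<lambda>v. f (0, v)) \<in> vcar (obj_dual ?V)"
      using f_add[of 0 0] f_scale[of 0] f_0 zero
      by (auto simp: obj_dual_def klinear_unit_iff)
    then obtain v where v: "v \<in> vcar ?V" "dual_map \<gamma> v = (\<lambda>v. f (0, v))"
      using bij(2) by (metis (no_types, lifting) bij_betw_def imageE)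
    have "dual_map (\<beta> \<boxplus> \<gamma>) (u, v) (x, y) = f (x, y)" for x y
      using fun_cong[OF u(2), of x] fun_cong[OF v(2), of y] f_add[of x 0 0 y] f_0[of x y] zero
      by (auto split: if_splits)
    then have "f = dual_map (\<beta> \<boxplus> \<gamma>) (u, v)"
      by auto
    then show "f \<in> dual_map (\<beta> \<boxplus> \<gamma>) ` vcar ?W"
      using u v by (intro image_eqI[of _ _ "(u, v)"]) auto
  qed
  ultimately show ?thesis
    using nondegenerate_form_iff[OF bilinear_form_sum[OF \<beta>(1) \<gamma>(1)]] by (simp add: bij_betw_def)
qed

lemma nondeg_sym_form_sum:
  "nondeg_sym_form \<beta> \<Longrightarrow> nondeg_sym_form \<gamma> \<Longrightarrow> nondeg_sym_form (\<beta> \<boxplus> \<gamma>)"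
  by (simp add: nondeg_sym_form_def bilinear_form_sum symmetric_form_sum nondegenerate_form_sum)

text \<open>
  Zero forms let the isomorphism lemmas for forms be reused for objects.
\<close>

definition zero_form :: "('k::field, 'v) vobj \<Rightarrow> ('k, 'v) vform" where
  "zero_form U = \<lparr>fobj = U, fval = (\<lambda>_ _. 0)\<rparr>"

lemma obj_isomorphic_iff: "obj_isomorphic U V \<longleftrightarrow> zero_form V \<simeq> zero_form U"
  by (simp add: obj_isomorphic_def form_isomorphic_def zero_form_def)

lemma zero_form_sum: "zero_form (obj_sum U V) = zero_form U \<boxplus> zero_form V"
  by (auto simp: zero_form_def form_sum_def fun_eq_iff)

lemma zero_form_copies_add:
  "zero_form (obj_copies (m + p) U) \<simeq> zero_form (obj_copies m U) \<boxplus> zero_form (obj_copies p U)"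
  by (rule form_isomorphicI[where
        \<phi> = "\<lambda>(f, g) i. if i < m then f i else g (i - m)"
        and \<psi> = "\<lambda>f. (\<lambda>i. if i < m then f i else 0, \<lambda>i. f (i + m))"])
    (auto simp: zero_form_def obj_copies_def fun_eq_iff)

lemma form_sum_interchange: "\<alpha> \<boxplus> \<beta> \<boxplus> (\<gamma> \<boxplus> \<delta>) \<simeq> \<alpha> \<boxplus> \<gamma> \<boxplus> (\<beta> \<boxplus> \<delta>)"
  by (rule form_isomorphicI[where
        \<phi> = "\<lambda>((a, c), (b, d)). ((a, b), (c, d))" and \<psi> = "\<lambda>((a, b), (c, d)). ((a, c), (b, d))"])
    (auto simp: ac_simps)

lemma obj_isomorphic_mn_sum:
  assumes "obj_isomorphic U (obj_mn m n)" "obj_isomorphic V (obj_mn p q)"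
  shows "obj_isomorphic (obj_sum U V) (obj_mn (m + p) (n + q))"
  unfolding obj_isomorphic_iff
proof -
  have "zero_form (obj_mn (m + p) (n + q) :: ('a, _) vobj) \<simeq>
      zero_form (obj_copies m obj_unit) \<boxplus> zero_form (obj_copies p obj_unit) \<boxplus>
      (zero_form (obj_copies n obj_P) \<boxplus> zero_form (obj_copies q obj_P))"
    unfolding obj_mn_def zero_form_sum by (intro form_sum_cong zero_form_copies_add)
  also have "\<dots> \<simeq> zero_form (obj_mn m n) \<boxplus> zero_form (obj_mn p q)"
    unfolding obj_mn_def zero_form_sum by (rule form_sum_interchange)
  also have "\<dots> \<simeq> zero_form (obj_sum U V)"
    unfolding zero_form_sum using assms by (intro form_sum_cong) (simp_all add: obj_isomorphic_iff)
  finally show "zero_form (obj_mn (m + p) (n + q)) \<simeq> zero_form (obj_sum U V)" .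
qed

theorem mainTheorem4:
  fixes \<beta> :: "('k::alg_closed_field, 'u::ab_group_add) vform"
    and \<eta> :: "('k, 'v::ab_group_add) vform"
    and m n p q :: nat
  assumes "CHAR('k) = 2"
    and "nondeg_sym_form \<beta>" and "obj_isomorphic (fobj \<beta>) (obj_mn m n)"
    and "nondeg_sym_form \<eta>" and "obj_isomorphic (fobj \<eta>) (obj_mn p q)"
  shows
    "let sum_in = (\<lambda>X. in_class X (m + p) (n + q) (\<beta> \<boxplus> \<eta>) \<and> in_class X (m + p) (n + q) (\<eta> \<boxplus> \<beta>)) in
     nondeg_sym_form (\<beta> \<boxplus> \<eta>) \<and> obj_isomorphic (fobj (\<beta> \<boxplus> \<eta>)) (obj_mn (m + p) (n + q)) \<and>
     (\<forall>a b.
       (in_class ClassA p q \<eta> \<longrightarrow>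
          (in_class ClassA m n \<beta> \<longrightarrow> sum_in ClassA) \<and>
          (in_class ClassC m n \<beta> \<longrightarrow> sum_in ClassA) \<and>
          (in_class ClassD m n \<beta> \<longrightarrow> sum_in ClassA) \<and>
          (in_class ClassB m n \<beta> \<longrightarrow> sum_in ClassB) \<and>
          (in_class (ClassE a) m n \<beta> \<longrightarrow> sum_in ClassB) \<and>
          (in_class (ClassF a) m n \<beta> \<longrightarrow> sum_in ClassB)) \<and>
       (in_class ClassB p q \<eta> \<longrightarrow>
          (\<forall>X. in_class X m n \<beta> \<longrightarrow> sum_in ClassB)) \<and>
       (in_class ClassC p q \<eta> \<longrightarrow>
          (in_class ClassC m n \<beta> \<longrightarrow> sum_in ClassC) \<and>
          (in_class ClassD m n \<beta> \<longrightarrow> sum_in ClassD) \<and>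
          (in_class (ClassE a) m n \<beta> \<longrightarrow> sum_in (ClassE a)) \<and>
          (in_class (ClassF a) m n \<beta> \<longrightarrow> sum_in (ClassF a))) \<and>
       (in_class ClassD p q \<eta> \<longrightarrow>
          (in_class ClassD m n \<beta> \<longrightarrow> sum_in ClassD) \<and>
          (in_class (ClassE a) m n \<beta> \<longrightarrow> sum_in (ClassF (of_nat n * a))) \<and>
          (in_class (ClassF a) m n \<beta> \<longrightarrow> sum_in (ClassF a))) \<and>
       (in_class (ClassE b) p q \<eta> \<longrightarrow>
          (in_class (ClassE a) m n \<beta> \<longrightarrow>
             (a = b \<longrightarrow> sum_in (ClassE a)) \<and>
             (a \<noteq> b \<longrightarrow> sum_in (ClassF (of_nat n * a + of_nat q * b)))) \<and>
          (in_class (ClassF a) m n \<beta> \<longrightarrow> sum_in (ClassF (a + of_nat q * b)))) \<and>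
       (in_class (ClassF b) p q \<eta> \<longrightarrow>
          (in_class (ClassF a) m n \<beta> \<longrightarrow> sum_in (ClassF (a + b)))))"
proof -
  note char2 = assms(1)
  define sum_in where "sum_in X \<longleftrightarrow>
    in_class X (m + p) (n + q) (\<beta> \<boxplus> \<eta>) \<and> in_class X (m + p) (n + q) (\<eta> \<boxplus> \<beta>)" for X
  have row: "sum_in Z"
    if "in_class Y p q \<eta>" "in_class X m n \<beta>" "class_sum_ok X m n Y p q Z" for X Y Z
    unfolding sum_in_def using in_class_sum[OF that(3,2,1)] .
  have row_A: "sum_in (if has_BP X then ClassB else ClassA)"
    if "in_class ClassA p q \<eta>" "in_class X m n \<beta>" for X
    using row[OF that class_sum_AB[OF char2 _ refl]] by (simp add: has_BP_def)
  have row_B: "sum_in ClassB"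
    if "in_class ClassB p q \<eta>" "in_class X m n \<beta>" for X
    using row[OF that class_sum_AB[OF char2 _ refl]] by (simp add: has_BP_def)
  note rows = row[OF _ _ class_sum_CC] row[OF _ _ class_sum_DC]
    row[OF _ _ class_sum_EC[OF char2]] row[OF _ _ class_sum_FC[OF char2]]
    row[OF _ _ class_sum_DD[OF char2]] row[OF _ _ class_sum_ED[OF char2]]
    row[OF _ _ class_sum_FD[OF char2]] row[OF _ _ class_sum_EE_eq]
    row[OF _ _ class_sum_EE[OF char2]] row[OF _ _ class_sum_FE[OF char2]]
    row[OF _ _ class_sum_FF[OF char2]]
  have "nondeg_sym_form (\<beta> \<boxplus> \<eta>)"
    using assms by (simp add: nondeg_sym_form_sum)
  moreover have "obj_isomorphic (fobj (\<beta> \<boxplus> \<eta>)) (obj_mn (m + p) (n + q))"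
    using obj_isomorphic_mn_sum[OF assms(3,5)] by (simp add: form_sum_def)
  ultimately show ?thesis
    unfolding Let_def sum_in_def[symmetric]
    \<comment> \<open>On each of the six constructors \<open>has_BP\<close> simplifies to a truth
      value, which turns \<open>row_A\<close> into the entries for class A.\<close>
    using row_A[of ClassA] row_A[of ClassB] row_A[of ClassC] row_A[of ClassD]
      row_A[of "ClassE a" for a] row_A[of "ClassF a" for a]
    by (intro conjI allI impI)
      (simp_all only: has_BP_def form_class.distinct form_class.inject simp_thms if_True if_False,
        (blast intro: row_B rows)+)
qed

end
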